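(* Let $q\ge2$ be a prime power and $V$ an $n$-dimensional vector space over $\mathbb{F}_q$. Let $n,k,t,s$ be positive integers with $k\ge t+2$ and $n\ge 3k+3t+1+\log_q(13s)$. Suppose that $\mathcal{F},\mathcal{G}\subseteq{V\brack k}$ are $s$-almost cross-$t$-intersecting but not cross-$t$-intersecting, that $|\mathcal{F}||\mathcal{G}|$ is maximum among all such pairs, and that $|\mathcal{F}|\le|\mathcal{G}|$. Then there exist $X\in{V\brack k+1}$ and $E\in{X\brack t}$ such that $$\mathcal{F}=\mathcal{H}_1(V,E;k)\setminus\mathcal{A}\quad\text{and}\quad\mathcal{G}=\mathcal{H}_1(V,E;k)\cup\mathcal{B},$$ where $\mathcal{A}$ is a $\left(q^{(k-t)(k-t+1)}{n-k-1\brack k-t}-s\right)$-element subset of $\mathcal{H}_2(X,E;k)$ and $\mathcal{B}$ is a $\min\{s,q^{k-t+1}{t\brack 1}\}$-element subset of ${X\brack k}\setminus\mathcal{H}_1(X,E;k)$.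
   Context: ${V\brack k}$ (resp. ${X\brack k}$) denotes the set of $k$-dimensional subspaces of $V$ (resp. of $X$). Gaussian binomial: ${a\brack b}=\prod_{0\le i<b}\frac{q^{a-i}-1}{q^{b-i}-1}$, ${a\brack 0}=1$, ${a\brack b}=0$ for $b<0$. For a family $\mathcal{G}$ and subspace $F$, $\mathcal{D}_{\mathcal{G}}(F;t)=\{G\in\mathcal{G}:\dim(G\cap F)<t\}$. $\mathcal{F},\mathcal{G}\subseteq{V\brack k}$ are $s$-almost cross-$t$-intersecting if $|\mathcal{D}_{\mathcal{G}}(F;t)|\le s$ for all $F\in\mathcal{F}$ and $|\mathcal{D}_{\mathcal{F}}(G;t)|\le s$ for all $G\in\mathcal{G}$; they are cross-$t$-intersecting if $\dim(F\cap G)\ge t$ for all $F\in\mathcal{F},G\in\mathcal{G}$. For subspaces $E\subseteq X$: $\mathcal{H}_1(X,E;k)=\{F\in{X\brack k}:E\subseteq F\}$ and $\mathcal{H}_2(X,E;k)=\{F\in{V\brack k}:F\cap X=E\}$. *)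

theory Defs
  imports Complex_Main
begin

definition gauss_binom :: "nat \<Rightarrow> int \<Rightarrow> int \<Rightarrow> real" where
  "gauss_binom q a b =
     (if b < 0 then 0
      else \<Prod>i<nat b. (real q powi (a - int i) - 1) / (real q powi (b - int i) - 1))"

text \<open>The ambient space \<open>V\<close> is the whole type of vectors, i.e. \<open>UNIV\<close>.\<close>

definition subspaces_of_dim :: "('a::field \<Rightarrow> 'b::ab_group_add \<Rightarrow> 'b) \<Rightarrow>
      'b set \<Rightarrow> nat \<Rightarrow> 'b set set" where
  "subspaces_of_dim scale X k = {U. module.subspace scale U \<and> U \<subseteq> X \<and> vector_space.dim scale U = k}"

definition deficient :: "('a::field \<Rightarrow> 'b::ab_group_add \<Rightarrow> 'b) \<Rightarrow>
      'b set set \<Rightarrow> 'b set \<Rightarrow> nat \<Rightarrow> 'b set set" where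
  "deficient scale \<G> F t = {G \<in> \<G>. vector_space.dim scale (G \<inter> F) < t}"

definition almost_cross_intersecting ::
    "('a::field \<Rightarrow> 'b::ab_group_add \<Rightarrow> 'b) \<Rightarrow>
      nat \<Rightarrow> nat \<Rightarrow> 'b set set \<Rightarrow> 'b set set \<Rightarrow> bool" where
  "almost_cross_intersecting scale s t \<F> \<G> \<longleftrightarrow>
     (\<forall>F\<in>\<F>. card (deficient scale \<G> F t) \<le> s) \<and> (\<forall>G\<in>\<G>. card (deficient scale \<F> G t) \<le> s)"

definition cross_intersecting :: "('a::field \<Rightarrow> 'b::ab_group_add \<Rightarrow> 'b) \<Rightarrow>
      nat \<Rightarrow> 'b set set \<Rightarrow> 'b set set \<Rightarrow> bool" where
  "cross_intersecting scale t \<F> \<G> \<longleftrightarrow> (\<forall>F\<in>\<F>. \<forall>G\<in>\<G>. t \<le> vector_space.dim scale (F \<inter> G))"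

definition H1 :: "('a::field \<Rightarrow> 'b::ab_group_add \<Rightarrow> 'b) \<Rightarrow>
      'b set \<Rightarrow> 'b set \<Rightarrow> nat \<Rightarrow> 'b set set" where
  "H1 scale X E k = {F \<in> subspaces_of_dim scale X k. E \<subseteq> F}"

definition H2 :: "('a::field \<Rightarrow> 'b::ab_group_add \<Rightarrow> 'b) \<Rightarrow>
      'b set \<Rightarrow> 'b set \<Rightarrow> nat \<Rightarrow> 'b set set" where
  "H2 scale X E k = {F \<in> subspaces_of_dim scale UNIV k. F \<inter> X = E}"

definition admissible_pair ::
    "('a::field \<Rightarrow> 'b::ab_group_add \<Rightarrow> 'b) \<Rightarrow>
      nat \<Rightarrow> nat \<Rightarrow> nat \<Rightarrow> 'b set set \<Rightarrow> 'b set set \<Rightarrow> bool" where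
  "admissible_pair scale k s t \<F> \<G> \<longleftrightarrow>
     \<F> \<subseteq> subspaces_of_dim scale UNIV k \<and> \<G> \<subseteq> subspaces_of_dim scale UNIV k \<and>
     almost_cross_intersecting scale s t \<F> \<G> \<and> \<not> cross_intersecting scale t \<F> \<G>"

end

theory Submission
  imports Defs
begin

text \<open>Let \<open>t + a\<close> and \<open>t + b\<close> be the least dimensions of subspaces meeting all members of \<open>\<F>\<close>,
  respectively of \<open>\<G>\<close>, in dimension at least \<open>t\<close>. Below these dimensions one can branch: a space
  \<open>T\<close> meeting some \<open>G\<close> in dimension less than \<open>t\<close> has, apart from \<open>s\<close> exceptions, only members of
  \<open>\<F>\<close> above it that contain some \<open>T + \<langle>v\<rangle>\<close> with \<open>v \<in> G\<close>. Each step gains a factor of about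
  \<open>q ^ (2 * k - n)\<close> and a cover costs a factor of at most \<open>q ^ (t + 1)\<close> per dimension, so the
  product of the sizes is too small unless, up to symmetry, \<open>a = 0\<close> and \<open>b \<le> 1\<close>. Then a
  \<open>t\<close>-space \<open>E\<close> lies in all members of \<open>\<F>\<close>, and every \<open>G \<in> \<G>\<close> without \<open>E\<close> meets \<open>E\<close> in a
  hyperplane of \<open>E\<close>. Two different sums \<open>G + E\<close> would halve \<open>\<F>\<close>; hence they all equal one
  \<open>X\<close>, the deficient pairs are exactly those of \<open>\<F> \<inter> H2 X E\<close> with the members of \<open>\<G>\<close> not containing
  \<open>E\<close>, and both sizes are bounded by those of the extremal pair.\<close>

section \<open>Counting subspaces\<close>

locale finite_field_space =
  finite_dimensional_vector_space scale Basis
  for scale :: "'a::{field,finite} \<Rightarrow> 'b::ab_group_add \<Rightarrow> 'b" (infixr "*s" 75) and Basis +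
  fixes q :: nat
  assumes q_card: "q = card (UNIV :: 'a set)"
begin

lemma q_ge_2: "2 \<le> q"
proof -
  have "card {0, 1 :: 'a} \<le> card (UNIV :: 'a set)"
    by (rule card_mono) auto
  then show ?thesis
    by (simp add: q_card)
qed

lemma finite_span_and_card:
  assumes "finite B" "independent B"
  shows "finite (span B) \<and> card (span B) = q ^ card B"
  using assms
proof (induction B rule: finite_induct)
  case empty
  then show ?case by simp
next
  case (insert v B)
  have ind: "independent B" and v: "v \<notin> span B"
    using insert.prems insert.hyps by (auto simp: independent_insert)
  have IH: "finite (span B)" "card (span B) = q ^ card B"
    using insert.IH[OF ind] by auto
  define f where "f = (\<lambda>(c, y). c *s v + y)"
  have img: "f ` (UNIV \<times> span B) = span (insert v B)"
  proof (intro set_eqI iffI)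
    fix x assume "x \<in> f ` (UNIV \<times> span B)"
    then obtain c y where "x = c *s v + y" "y \<in> span B" by (auto simp: f_def)
    then show "x \<in> span (insert v B)"
      by (auto simp: span_breakdown_eq intro!: exI[of _ c])
  next
    fix x assume "x \<in> span (insert v B)"
    then obtain c where "x - c *s v \<in> span B" by (auto simp: span_breakdown_eq)
    then show "x \<in> f ` (UNIV \<times> span B)"
      by (auto simp: f_def intro!: image_eqI[of _ _ "(c, x - c *s v)"])
  qed
  have inj: "inj_on f (UNIV \<times> span B)"
  proof (rule inj_onI)
    fix x y assume xy: "x \<in> UNIV \<times> span B" "y \<in> UNIV \<times> span B" "f x = f y"
    obtain a u where x: "x = (a, u)" by (cases x)
    obtain b w where y: "y = (b, w)" by (cases y)
    have uw: "u \<in> span B" "w \<in> span B" using xy x y by auto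
    have "(a - b) *s v = w - u"
      using xy(3) by (simp add: x y f_def algebra_simps)
    then have m: "(a - b) *s v \<in> span B" using uw by (simp add: span_diff)
    have "a = b"
    proof (rule ccontr)
      assume "a \<noteq> b"
      then have "v = inverse (a - b) *s ((a - b) *s v)" by simp
      then show False using m v span_scale by metis
    qed
    then show "x = y" using xy(3) by (simp add: x y f_def)
  qed
  have "card (span (insert v B)) = card (UNIV \<times> span B :: ('a \<times> 'b) set)"
    using card_image[OF inj] img by simp
  also have "\<dots> = q * q ^ card B"
    using IH by (simp add: card_cartesian_product q_card)
  finally have "card (span (insert v B)) = q ^ card (insert v B)"
    using insert.hyps by simp
  moreover have "finite (span (insert v B))"
    unfolding img[symmetric] using IH by auto
  ultimately show ?case by blast
qed

lemma finite_space [simp]: "finite (S :: 'b set)"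
proof -
  have "finite (UNIV :: 'b set)"
    using finite_span_and_card[OF finite_Basis independent_Basis] by (simp add: span_Basis)
  then show ?thesis by (rule rev_finite_subset) simp
qed

lemma finite_families [simp]: "finite (\<F> :: 'b set set)"
  by (rule finite_subset[OF subset_Pow_Union]) (simp only: finite_Pow_iff finite_space)

lemma card_subspace:
  assumes "subspace S"
  shows "card S = q ^ dim S"
  using basis_subspace_exists[OF assms] finite_span_and_card by metis

text \<open>One notion serves two counts: \<open>X = E\<close> gives the subspaces between
  \<open>E\<close> and \<open>Y\<close> (\<open>between_eq_ext\<close>), and \<open>Y = UNIV\<close>
  gives \<open>H2\<close> (\<open>H2_eq_ext\<close>).\<close>

definition ext :: "'b set \<Rightarrow> 'b set \<Rightarrow> 'b set \<Rightarrow> nat \<Rightarrow> 'b set set" where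
  "ext X E Y m = {F. subspace F \<and> F \<subseteq> Y \<and> F \<inter> X = E \<and> dim F = m}"

lemma dim_span_insert:
  assumes "subspace S" "v \<notin> S"
  shows "dim (span (insert v S)) = Suc (dim S)"
  by (metis assms dim_insert dim_span span_eq_iff Suc_eq_plus1)

lemma span_insert_subset:
  assumes "subspace Y" "S \<subseteq> Y" "v \<in> Y"
  shows "span (insert v S) \<subseteq> Y"
  using assms by (intro span_minimal) auto

text \<open>As \<open>v\<close> lies outside \<open>X\<close>, its only multiple in \<open>X\<close>
  is 0. So enlarging both \<open>X\<close> and \<open>E\<close> by \<open>v\<close> keeps the
  condition on \<open>F \<inter> X\<close> and merely adds \<open>v \<in> F\<close>.\<close>

lemma ext_insert_iff:
  assumes "subspace E" "subspace X" "E \<subseteq> X" "v \<notin> X" "subspace F"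
  shows "F \<inter> span (insert v X) = span (insert v E) \<longleftrightarrow> v \<in> F \<and> F \<inter> X = E"
proof
  assume L: "F \<inter> span (insert v X) = span (insert v E)"
  have vF: "v \<in> F" using L span_base[of v "insert v E"] by auto
  have "F \<inter> X = E"
  proof
    show "E \<subseteq> F \<inter> X" using L assms(3) span_superset[of "insert v E"] by auto
    show "F \<inter> X \<subseteq> E"
    proof
      fix x assume x: "x \<in> F \<inter> X"
      then have "x \<in> span (insert v E)" using L span_superset[of "insert v X"] by auto
      then obtain c where c: "x - c *s v \<in> span E" by (auto simp: span_breakdown_eq)
      then have cE: "x - c *s v \<in> E" using assms(1) by (metis span_eq_iff)
      have "c = 0"
      proof (rule ccontr)
        assume "c \<noteq> 0"
        have "x - (x - c *s v) \<in> X"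
          using x cE assms(2,3) subspace_diff[of X x "x - c *s v"] by blast
        then have "c *s v \<in> X" by simp
        then have "inverse c *s (c *s v) \<in> X"
          by (rule subspace_scale[OF assms(2)])
        then show False using \<open>c \<noteq> 0\<close> assms(4) by simp
      qed
      then show "x \<in> E" using cE by simp
    qed
  qed
  then show "v \<in> F \<and> F \<inter> X = E" using vF by simp
next
  assume R: "v \<in> F \<and> F \<inter> X = E"
  show "F \<inter> span (insert v X) = span (insert v E)"
  proof
    show "span (insert v E) \<subseteq> F \<inter> span (insert v X)"
      using R assms span_mono[of "insert v E" "insert v X"] span_insert_subset[of F E v] by blast
    show "F \<inter> span (insert v X) \<subseteq> span (insert v E)"
    proof
      fix x assume x: "x \<in> F \<inter> span (insert v X)"
      then obtain c where "x - c *s v \<in> span X" by (auto simp: span_breakdown_eq)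
      then have "x - c *s v \<in> X" using assms(2) by (metis span_eq_iff)
      moreover have "x - c *s v \<in> F"
        using x R assms(5) by (auto intro!: subspace_diff subspace_scale)
      ultimately have "x - c *s v \<in> E" using R by blast
      then show "x \<in> span (insert v E)"
        by (auto simp: span_breakdown_eq intro!: exI[of _ c] span_base)
    qed
  qed
qed

text \<open>Double counting of the pairs \<open>(v, F)\<close> with \<open>v \<in> F - E\<close>: such an \<open>F\<close> is an extension of
  \<open>E + \<langle>v\<rangle>\<close> relative to \<open>X + \<langle>v\<rangle>\<close>.\<close>

lemma card_ext_Suc:
  assumes "subspace E" "subspace X" "subspace Y" "E \<subseteq> X" "X \<subseteq> Y"
  shows "card (ext X E Y m) * (q ^ m - q ^ dim E) =
    (\<Sum>v\<in>Y - X. card (ext (span (insert v X)) (span (insert v E)) Y m))"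
proof -
  define S where "S = (SIGMA F:ext X E Y m. F - E)"
  define S' where "S' = (SIGMA v:Y - X. ext (span (insert v X)) (span (insert v E)) Y m)"
  have "bij_betw prod.swap S S'"
  proof (rule bij_betw_imageI)
    show "inj_on prod.swap S" by (auto simp: inj_on_def)
    show "prod.swap ` S = S'"
    proof (intro set_eqI iffI)
      fix z assume "z \<in> prod.swap ` S"
      then obtain F v where z: "z = (v, F)" "F \<in> ext X E Y m" "v \<in> F" "v \<notin> E"
        by (auto simp: S_def)
      then have "v \<in> Y - X" by (auto simp: ext_def)
      then show "z \<in> S'"
        using z ext_insert_iff[OF assms(1,2,4), of v F] by (auto simp: S'_def ext_def)
    next
      fix z assume "z \<in> S'"
      then obtain F v where z: "z = (v, F)" "v \<in> Y" "v \<notin> X"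
          "F \<in> ext (span (insert v X)) (span (insert v E)) Y m"
        by (auto simp: S'_def)
      then have "(F, v) \<in> S"
        using ext_insert_iff[OF assms(1,2,4), of v F] assms(4) by (auto simp: S_def ext_def)
      then show "z \<in> prod.swap ` S" using z by (force intro: image_eqI[of _ _ "(F, v)"])
    qed
  qed
  then have eq: "card S = card S'" by (rule bij_betw_same_card)
  have "card (F - E) = q ^ m - q ^ dim E" if "F \<in> ext X E Y m" for F
    using that assms(1) by (auto simp: ext_def card_Diff_subset card_subspace)
  then have "card S = card (ext X E Y m) * (q ^ m - q ^ dim E)"
    by (simp add: S_def)
  then show ?thesis using eq by (simp add: S'_def)
qed

text \<open>Both sides count the \<open>j\<close>-tuples in \<open>Y\<close> that are independent
  modulo \<open>X\<close>: together with \<open>E\<close> each spans one \<open>F\<close>, and each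
  \<open>F\<close> arises from all its \<open>j\<close>-tuples independent modulo \<open>E\<close>.
  The induction splits off the first vector.\<close>

lemma card_ext:
  assumes "subspace E" "subspace X" "subspace Y" "E \<subseteq> X" "X \<subseteq> Y"
  shows "real (card (ext X E Y (dim E + j))) * (\<Prod>i<j. real q ^ (dim E + j) - real q ^ (dim E + i))
    = (\<Prod>i<j. real q ^ dim Y - real q ^ (dim X + i))"
  using assms
proof (induction j arbitrary: E X)
  case 0
  have "ext X E Y (dim E) = {E}"
  proof (intro set_eqI iffI)
    fix F assume "F \<in> ext X E Y (dim E)"
    then have F: "subspace F" "F \<inter> X = E" "dim F = dim E" by (auto simp: ext_def)
    then have "E = F" using subspace_dim_equal[of E F] 0 by auto
    then show "F \<in> {E}" by simp
  qed (use 0 in \<open>auto simp: ext_def\<close>)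
  then show ?case by simp
next
  case (Suc j)
  let ?e = "dim E" and ?x = "dim X" and ?q = "real q"
  \<comment> \<open>These two bounds keep the natural subtractions in \<open>card_ext_Suc\<close>
    and in the size of \<open>Y - X\<close> from truncating.\<close>
  have pow: "q ^ ?e \<le> q ^ (?e + Suc j)" using q_ge_2 by (intro power_increasing) auto
  have powY: "q ^ ?x \<le> q ^ dim Y" using q_ge_2 Suc.prems by (intro power_increasing dim_subset) auto
  have step: "real (card (ext (span (insert v X)) (span (insert v E)) Y (?e + Suc j)))
      * (\<Prod>i<j. ?q ^ (?e + Suc j) - ?q ^ (?e + Suc i)) = (\<Prod>i<j. ?q ^ dim Y - ?q ^ (?x + Suc i))"
    if v: "v \<in> Y - X" for v
  proof -
    have d: "dim (span (insert v X)) = Suc ?x" "dim (span (insert v E)) = Suc ?e"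
      using v Suc.prems dim_span_insert[of X v] dim_span_insert[of E v] by blast+
    have "span (insert v E) \<subseteq> span (insert v X)" "span (insert v X) \<subseteq> Y"
      using Suc.prems v span_mono[of "insert v E" "insert v X"] span_insert_subset[of Y X v] by blast+
    then show ?thesis
      using Suc.IH[of "span (insert v E)" "span (insert v X)"] Suc.prems(3) unfolding d by simp
  qed
  have "real (card (ext X E Y (?e + Suc j))) *
      (\<Prod>i<Suc j. ?q ^ (?e + Suc j) - ?q ^ (?e + i))
    = real (card (ext X E Y (?e + Suc j)) * (q ^ (?e + Suc j) - q ^ ?e)) *
      (\<Prod>i<j. ?q ^ (?e + Suc j) - ?q ^ (?e + Suc i))"
    using pow by (simp add: prod.lessThan_Suc_shift of_nat_diff del: prod.lessThan_Suc)
  also have "\<dots> = (\<Sum>v\<in>Y - X. real (card (ext (span (insert v X)) (span (insert v E)) Y (?e + Suc j)))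
      * (\<Prod>i<j. ?q ^ (?e + Suc j) - ?q ^ (?e + Suc i)))"
    unfolding card_ext_Suc[OF Suc.prems] by (simp add: sum_distrib_right)
  also have "\<dots> = (\<Sum>v\<in>Y - X. \<Prod>i<j. ?q ^ dim Y - ?q ^ (?x + Suc i))"
    by (rule sum.cong[OF refl step])
  also have "\<dots> = (?q ^ dim Y - ?q ^ ?x) * (\<Prod>i<j. ?q ^ dim Y - ?q ^ (?x + Suc i))"
    using Suc.prems powY by (simp add: card_Diff_subset card_subspace of_nat_diff)
  also have "\<dots> = (\<Prod>i<Suc j. ?q ^ dim Y - ?q ^ (?x + i))"
    by (simp add: prod.lessThan_Suc_shift del: prod.lessThan_Suc)
  finally show ?case .
qed

section \<open>Gaussian binomial coefficients\<close>

definition gb :: "nat \<Rightarrow> nat \<Rightarrow> real" where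
  "gb y j = (\<Prod>i<j. (real q ^ y - real q ^ i) / (real q ^ j - real q ^ i))"

lemma q_real: "2 \<le> real q"
  using q_ge_2 by simp

lemma q_pow_pos [simp]: "0 < real q ^ m"
  using q_real by simp

lemma q_pow_less: "i < j \<Longrightarrow> real q ^ i < real q ^ j"
  using q_real by simp

lemma q_pow_mono: "i \<le> j \<Longrightarrow> real q ^ i \<le> real q ^ j"
  using q_real by simp

lemma q_pow_double: "2 * real q ^ m \<le> real q ^ Suc m"
  using q_real by (simp add: mult_right_mono)

lemma q_pow_gt_1: "0 < j \<Longrightarrow> 1 < real q ^ j"
  using q_real by simp

lemma gb_0 [simp]: "gb y 0 = 1"
  by (simp add: gb_def)

lemma gb_Suc_Suc: "gb (Suc y) (Suc j) = (real q ^ Suc y - 1) / (real q ^ Suc j - 1) * gb y j"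
proof -
  have "(real q ^ Suc y - real q ^ Suc i) / (real q ^ Suc j - real q ^ Suc i)
    = (real q ^ y - real q ^ i) / (real q ^ j - real q ^ i)" for i
  proof -
    have "real q ^ Suc y - real q ^ Suc i = real q * (real q ^ y - real q ^ i)"
      "real q ^ Suc j - real q ^ Suc i = real q * (real q ^ j - real q ^ i)"
      by (simp_all add: algebra_simps)
    then show ?thesis using q_real by (simp only:) simp
  qed
  then show ?thesis
    by (simp add: gb_def prod.lessThan_Suc_shift del: prod.lessThan_Suc power_Suc)
qed

lemma gb_1: "gb y 1 = (real q ^ y - 1) / (real q - 1)"
  by (simp add: gb_def)

lemma gb_factorial:
  "gb (a + b) b = (\<Prod>i<a + b. real q ^ Suc i - 1) / ((\<Prod>i<a. real q ^ Suc i - 1) * (\<Prod>i<b. real q ^ Suc i - 1))"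
proof (induction b)
  case 0
  have "(\<Prod>i<a. real q ^ Suc i - 1) \<noteq> 0"
    using q_pow_gt_1[of "Suc _"] by (auto simp del: power_Suc) (metis less_irrefl zero_less_Suc)
  then show ?case by simp
next
  case (Suc b)
  then show ?case by (simp add: gb_Suc_Suc mult_ac del: power_Suc)
qed

lemma gb_sym: "gb (a + b) a = gb (a + b) b"
  using gb_factorial[of a b] gb_factorial[of b a] by (simp add: add.commute mult.commute)

lemma gb_hyperplane: "gb (Suc j) j = (real q ^ Suc j - 1) / (real q - 1)"
  using gb_sym[of 1 j] gb_1[of "Suc j"] by simp

text \<open>Raising \<open>d\<close> by one multiplies the coefficient by (q^(t+d+1) - 1) / (q^(d+1)
  - 1), which is less than q^(t+1). This is the cost of a cover per dimension.\<close>

lemma gb_less: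
  assumes "0 < d"
  shows "gb (t + d) t < real q ^ ((t + 1) * d)"
proof -
  \<comment> \<open>The induction starts at \<open>d = 0\<close>, where only the weak bound holds;
    positivity is carried along for multiplying the inequalities.\<close>
  have "gb (t + d) d \<le> real q ^ ((t + 1) * d) \<and> (0 < d \<longrightarrow> gb (t + d) d < real q ^ ((t + 1) * d))
      \<and> 0 < gb (t + d) d" for d
  proof (induction d)
    case (Suc d)
    define c where "c = (real q ^ Suc (t + d) - 1) / (real q ^ Suc d - 1)"
    have d1: "1 < real q ^ Suc d" by (rule q_pow_gt_1) simp
    have cpos: "0 < c" unfolding c_def using d1 q_pow_gt_1[of "Suc (t + d)"] by simp
    have "2 * real q ^ Suc (t + d) \<le> real q ^ Suc (Suc (t + d))" by (rule q_pow_double)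
    moreover have "real q ^ Suc t \<le> real q ^ Suc (t + d)" by (rule q_pow_mono) simp
    ultimately have "real q ^ Suc (t + d) - 1 < real q ^ (t + 1) * (real q ^ Suc d - 1)"
      by (simp add: algebra_simps power_add)
    then have clt: "c < real q ^ (t + 1)"
      unfolding c_def using d1 by (simp add: pos_divide_less_eq del: power_Suc)
    have eq: "gb (t + Suc d) (Suc d) = c * gb (t + d) d"
      by (simp add: gb_Suc_Suc c_def del: power_Suc)
    have "c * gb (t + d) d < real q ^ (t + 1) * gb (t + d) d"
      using clt Suc by simp
    also have "\<dots> \<le> real q ^ (t + 1) * real q ^ ((t + 1) * d)"
      using Suc by (intro mult_left_mono) auto
    also have "\<dots> = real q ^ ((t + 1) * Suc d)"
      by (simp add: power_add[symmetric])
    finally show ?case using cpos Suc unfolding eq by (simp del: power_Suc)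
  qed simp
  then show ?thesis using assms gb_sym[of t d] by simp
qed

section \<open>Counting subspaces between two given ones\<close>

definition between :: "'b set \<Rightarrow> 'b set \<Rightarrow> nat \<Rightarrow> 'b set set" where
  "between T Y m = {F. subspace F \<and> T \<subseteq> F \<and> F \<subseteq> Y \<and> dim F = m}"

lemma between_eq_ext: "between T Y m = ext T T Y m"
  by (auto simp: between_def ext_def)

lemma real_card_ext:
  assumes "subspace E" "subspace X" "subspace Y" "E \<subseteq> X" "X \<subseteq> Y"
  shows "real (card (ext X E Y (dim E + j))) =
    (\<Prod>i<j. (real q ^ dim Y - real q ^ (dim X + i)) / (real q ^ (dim E + j) - real q ^ (dim E + i)))"
proof -
  have "(\<Prod>i<j. real q ^ (dim E + j) - real q ^ (dim E + i)) \<noteq> 0"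
    using q_pow_less by (force simp: prod_zero_iff)
  then show ?thesis
    using card_ext[OF assms, of j] by (simp add: prod_dividef nonzero_eq_divide_eq)
qed

lemma card_between:
  assumes "subspace T" "subspace Y" "T \<subseteq> Y"
  shows "real (card (between T Y (dim T + j))) = gb (dim Y - dim T) j"
proof -
  have le: "dim T \<le> dim Y" using assms(3) by (rule dim_subset)
  have "(real q ^ dim Y - real q ^ (dim T + i)) / (real q ^ (dim T + j) - real q ^ (dim T + i))
    = (real q ^ (dim Y - dim T) - real q ^ i) / (real q ^ j - real q ^ i)" for i
  proof -
    have "real q ^ dim Y = real q ^ dim T * real q ^ (dim Y - dim T)"
      using le by (simp add: power_add[symmetric])
    then have "real q ^ dim Y - real q ^ (dim T + i) = real q ^ dim T * (real q ^ (dim Y - dim T) - real q ^ i)"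
      "real q ^ (dim T + j) - real q ^ (dim T + i) = real q ^ dim T * (real q ^ j - real q ^ i)"
      by (simp_all add: algebra_simps power_add)
    then show ?thesis using q_real by (simp only:) simp
  qed
  then show ?thesis
    unfolding between_eq_ext gb_def using real_card_ext[of T T Y j] assms by simp
qed

lemma card_points:
  assumes "subspace T" "subspace Y" "T \<subseteq> Y"
  shows "real (card (between T Y (Suc (dim T)))) = (real q ^ (dim Y - dim T) - 1) / (real q - 1)"
  using card_between[OF assms, of 1] gb_1 by simp

text \<open>The \<open>- 1\<close> leaves room for one exceptional family: if it obeys the same
  bound as each of the branches, the total is at most \<open>q ^ m\<close> times that bound.\<close>

lemma card_points_le:
  assumes "subspace T" "subspace Y" "T \<subseteq> Y" "dim Y \<le> dim T + m"
  shows "real (card (between T Y (Suc (dim T)))) \<le> real q ^ m - 1"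
proof -
  have "real q ^ (dim Y - dim T) \<le> real q ^ m" using assms by (intro q_pow_mono) simp
  moreover have "(real q ^ (dim Y - dim T) - 1) / (real q - 1) \<le> (real q ^ (dim Y - dim T) - 1) / 1"
    using q_real one_le_power[of "real q" "dim Y - dim T"] by (intro divide_left_mono) auto
  ultimately show ?thesis using card_points[OF assms(1-3)] by simp
qed

text \<open>Integrality turns the strict inequality of \<open>gb_less\<close> into a gap of 1, again
  to absorb an exceptional family.\<close>

lemma card_subspaces_less:
  assumes "subspace Y" "dim Y = t + d" "0 < d"
  shows "real (card (between {0} Y t)) \<le> real q ^ ((t + 1) * d) - 1"
proof -
  have "real (card (between {0} Y t)) = gb (t + d) t"
    using card_between[of "{0}" Y t] assms subspace_0[of Y] by simp
  then have "real (card (between {0} Y t)) < real (q ^ ((t + 1) * d))"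
    using gb_less[of d t] assms by simp
  then have "card (between {0} Y t) < q ^ ((t + 1) * d)" by (simp only: of_nat_less_iff)
  then have "real (Suc (card (between {0} Y t))) \<le> real (q ^ ((t + 1) * d))"
    by (simp only: of_nat_le_iff Suc_le_eq)
  then show ?thesis by simp
qed

lemma real_card_union_bound:
  fixes \<A> :: "'b set set"
  assumes "\<A> \<subseteq> \<D> \<union> (\<Union>T\<in>\<T>. \<B> T)" "real (card \<D>) \<le> Z"
    and "\<And>T. T \<in> \<T> \<Longrightarrow> real (card (\<B> T)) \<le> y" "real (card (\<T> :: 'b set set)) \<le> c" "0 \<le> y"
  shows "real (card \<A>) \<le> Z + c * y"
proof -
  have "card \<A> \<le> card (\<D> \<union> (\<Union>T\<in>\<T>. \<B> T))" using assms(1) by (rule card_mono[rotated]) simp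
  also have "\<dots> \<le> card \<D> + card (\<Union>T\<in>\<T>. \<B> T)" by (rule card_Un_le)
  also have "card (\<Union>T\<in>\<T>. \<B> T) \<le> (\<Sum>T\<in>\<T>. card (\<B> T))" by (rule card_UN_le) simp
  finally have "real (card \<A>) \<le> real (card \<D>) + (\<Sum>T\<in>\<T>. real (card (\<B> T)))"
    by (simp flip: of_nat_sum of_nat_add)
  also have "(\<Sum>T\<in>\<T>. real (card (\<B> T))) \<le> (\<Sum>T\<in>\<T>. y)" by (rule sum_mono) (rule assms(3))
  also have "(\<Sum>T\<in>\<T>. y) = real (card \<T>) * y" by simp
  also have "\<dots> \<le> c * y" using assms(4,5) by (rule mult_right_mono)
  finally show ?thesis using assms(2) by simp
qed

lemma dim_span_Un:
  assumes "subspace S" "subspace T"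
  shows "dim (span (S \<union> T)) + dim (S \<inter> T) = dim S + dim T"
proof -
  have "span (S \<union> T) = {x + y |x y. x \<in> S \<and> y \<in> T}"
    unfolding span_Un using assms by (metis span_eq_iff)
  then show ?thesis using dim_sums_Int[OF assms] by simp
qed

lemma mem_subspaces_of_dim: "F \<in> subspaces_of_dim scale X m \<longleftrightarrow> subspace F \<and> F \<subseteq> X \<and> dim F = m"
  by (simp add: subspaces_of_dim_def)

end

section \<open>Branching and covers\<close>

text \<open>\<open>q_pow_n\<close> is the lower bound on \<open>n\<close> with the logarithm
  exponentiated away; the conversion is made in the final theorem.\<close>

locale intersecting_setup = finite_field_space scale Basis q
  for scale :: "'a::{field,finite} \<Rightarrow> 'b::ab_group_add \<Rightarrow> 'b" (infixr "*s" 75) and Basis q +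
  fixes n k t s :: nat
  assumes dim_space: "card Basis = n"
    and t_pos: "0 < t" and s_pos: "0 < s" and k_ge: "t + 2 \<le> k" and n_ge: "2 * k + 1 \<le> n"
    and q_pow_n: "13 * real s * real q ^ (2 * k + 3 * t + 1) \<le> real q ^ (n - k)"
begin

text \<open>The number of \<open>k\<close>-dimensional subspaces containing a given \<open>j\<close>-dimensional one.\<close>

definition N :: "nat \<Rightarrow> real" where
  "N j = gb (n - j) (k - j)"

definition Sub :: "'b set set" where
  "Sub = subspaces_of_dim scale UNIV k"

definition fam :: "'b set set \<Rightarrow> 'b set \<Rightarrow> 'b set set" where
  "fam \<F> T = {F \<in> \<F>. T \<subseteq> F}"

abbreviation "def \<equiv> deficient scale"

lemma mem_Sub: "F \<in> Sub \<longleftrightarrow> subspace F \<and> dim F = k"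
  by (simp add: Sub_def mem_subspaces_of_dim)

lemma N_k [simp]: "N k = 1"
  by (simp add: N_def)

lemma N_Suc:
  assumes "j < k"
  shows "N j = (real q ^ (n - j) - 1) / (real q ^ (k - j) - 1) * N (Suc j)"
proof -
  have "n - j = Suc (n - Suc j)" "k - j = Suc (k - Suc j)" using assms n_ge by auto
  then show ?thesis using gb_Suc_Suc[of "n - Suc j" "k - Suc j"] by (simp only: N_def)
qed

lemma N_pos: "j \<le> k \<Longrightarrow> 0 < N j"
proof (induction "k - j" arbitrary: j)
  case (Suc x)
  then have "j < k" by simp
  moreover have "0 < N (Suc j)" using Suc by simp
  moreover have "1 < real q ^ (n - j)" "1 < real q ^ (k - j)"
    using \<open>j < k\<close> n_ge by (auto intro!: q_pow_gt_1)
  ultimately show ?case using N_Suc[of j] by simp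
qed simp

text \<open>The ratio (q^(n-j) - 1) / (q^(k-j) - 1) of consecutive values is at least q^(n-k): this
  is the gain of fixing one more dimension.\<close>

lemma N_Suc_le:
  assumes "j < k"
  shows "real q ^ (n - k) * N (Suc j) \<le> N j"
proof -
  have gt: "1 < real q ^ (k - j)" using assms by (intro q_pow_gt_1) auto
  have "real q ^ (n - k) * real q ^ (k - j) = real q ^ (n - j)"
    using assms n_ge by (simp flip: power_add)
  moreover have "1 \<le> real q ^ (n - k)" using q_real by (intro one_le_power) simp
  ultimately have "real q ^ (n - k) * (real q ^ (k - j) - 1) \<le> real q ^ (n - j) - 1"
    by (simp add: algebra_simps)
  then have "real q ^ (n - k) \<le> (real q ^ (n - j) - 1) / (real q ^ (k - j) - 1)"
    using gt by (simp add: pos_le_divide_eq)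
  then show ?thesis
    unfolding N_Suc[OF assms] using N_pos[of "Suc j"] assms by (intro mult_right_mono) auto
qed

lemma card_above:
  assumes "subspace T" "dim T \<le> k"
  shows "real (card (between T UNIV k)) = N (dim T)"
  using card_between[of T UNIV "k - dim T"] assms by (simp add: N_def dim_space)

lemma card_fam_le:
  assumes "\<F> \<subseteq> Sub" "subspace T" "dim T \<le> k"
  shows "real (card (fam \<F> T)) \<le> N (dim T)"
proof -
  have "fam \<F> T \<subseteq> between T UNIV k"
    using assms by (auto simp: fam_def between_def mem_Sub)
  then have "card (fam \<F> T) \<le> card (between T UNIV k)" by (intro card_mono) auto
  then show ?thesis using card_above[OF assms(2,3)] by simp
qed

text \<open>If \<open>G\<close> meets \<open>T\<close> in dimension less than \<open>t\<close>, then all but \<open>s\<close> members of \<open>\<F>\<close> through \<open>T\<close>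
  contain one of the fewer than \<open>q ^ k\<close> spaces \<open>T + \<langle>v\<rangle>\<close> with \<open>v \<in> G\<close>.\<close>

lemma branching:
  assumes \<F>: "\<F> \<subseteq> Sub" and \<G>: "\<G> \<subseteq> Sub" and few: "\<And>G. G \<in> \<G> \<Longrightarrow> card (def \<F> G t) \<le> s"
    and "subspace T" "dim T + d \<le> k"
    and "\<And>T'. subspace T' \<Longrightarrow> T \<subseteq> T' \<Longrightarrow> dim T' < dim T + d \<Longrightarrow> \<exists>G\<in>\<G>. dim (G \<inter> T') < t"
  shows "real (card (fam \<F> T)) \<le> real q ^ (k * d) * max (real s) (N (dim T + d))"
  using assms(4-)
proof (induction d arbitrary: T)
  case 0
  then show ?case using card_fam_le[OF \<F>, of T] by simp
next
  case (Suc d)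
  let ?y = "real q ^ (k * d) * max (real s) (N (dim T + Suc d))"
  obtain G where G: "G \<in> \<G>" "dim (G \<inter> T) < t"
    using Suc.prems(3)[of T] Suc.prems(1) by auto
  have sG: "subspace G" "dim G = k" using G \<G> by (auto simp: mem_Sub)
  let ?Y = "span (T \<union> G)"
  have dY: "dim ?Y \<le> dim T + k"
    using dim_span_Un[of T G] sG Suc.prems(1) by simp
  have sub: "fam \<F> T \<subseteq> def \<F> G t \<union> (\<Union>T'\<in>between T ?Y (Suc (dim T)). fam \<F> T')"
  proof
    fix F assume F: "F \<in> fam \<F> T"
    then have F': "F \<in> \<F>" "T \<subseteq> F" "subspace F" using \<F> by (auto simp: fam_def mem_Sub)
    show "F \<in> def \<F> G t \<union> (\<Union>T'\<in>between T ?Y (Suc (dim T)). fam \<F> T')"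
    proof (cases "dim (F \<inter> G) < t")
      case True
      then show ?thesis using F' by (simp add: deficient_def)
    next
      case False
      then have "\<not> F \<inter> G \<subseteq> G \<inter> T" using G(2) dim_subset[of "F \<inter> G" "G \<inter> T"] by linarith
      then obtain v where v: "v \<in> F" "v \<in> G" "v \<notin> T" by auto
      have "span (insert v T) \<subseteq> F" using v F' by (intro span_insert_subset) auto
      moreover have "span (insert v T) \<subseteq> ?Y" using v by (intro span_mono) auto
      ultimately have "span (insert v T) \<in> between T ?Y (Suc (dim T))" "F \<in> fam \<F> (span (insert v T))"
        using dim_span_insert[of T v] v Suc.prems(1) F' span_superset[of "insert v T"]
        by (auto simp: between_def fam_def simp del: dim_span)
      then show ?thesis by blast
    qed
  qed
  have y: "real (card (fam \<F> T')) \<le> ?y" if "T' \<in> between T ?Y (Suc (dim T))" for T'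
  proof -
    have T': "subspace T'" "T \<subseteq> T'" "dim T' = Suc (dim T)" using that by (auto simp: between_def)
    have "real (card (fam \<F> T')) \<le> real q ^ (k * d) * max (real s) (N (dim T' + d))"
    proof (rule Suc.IH)
      show "\<exists>G\<in>\<G>. dim (G \<inter> T'') < t" if "subspace T''" "T' \<subseteq> T''" "dim T'' < dim T' + d" for T''
        using Suc.prems(3)[of T''] that T' by auto
    qed (use T' Suc.prems in auto)
    then show ?thesis using T' by simp
  qed
  have one: "1 \<le> real q ^ (k * d)" using q_real by (intro one_le_power) simp
  have "real s \<le> 1 * max (real s) (N (dim T + Suc d))" by simp
  also have "\<dots> \<le> ?y" using one by (intro mult_right_mono) auto
  finally have sy: "real s \<le> ?y" .
  have "real (card (fam \<F> T)) \<le> ?y + (real q ^ k - 1) * ?y"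
  proof (rule real_card_union_bound[OF sub _ y])
    show "real (card (def \<F> G t)) \<le> ?y" using few[OF G(1)] sy by simp
    show "real (card (between T ?Y (Suc (dim T)))) \<le> real q ^ k - 1"
      using Suc.prems(1) dY span_superset[of "T \<union> G"] by (intro card_points_le) auto
    show "0 \<le> ?y" using sy by simp
  qed auto
  also have "\<dots> = real q ^ (k * Suc d) * max (real s) (N (dim T + Suc d))"
    by (simp add: algebra_simps power_add)
  finally show ?case .
qed

text \<open>A member of \<open>\<F>\<close> meeting \<open>T\<close> in dimension at least
  \<open>t\<close> contains one of the fewer than q^((t+1)d) \<open>t\<close>-subspaces of
  \<open>T\<close>. Allowing exceptions lets a member of the other family play the role of
  \<open>T\<close>.\<close>

lemma card_le_of_cover:
  assumes \<F>: "\<F> \<subseteq> Sub" and T: "subspace T" "dim T = t + d" "0 < d"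
    and "real (card (def \<F> T t)) \<le> y"
    and y: "\<And>E. subspace E \<Longrightarrow> dim E = t \<Longrightarrow> real (card (fam \<F> E)) \<le> y"
  shows "real (card \<F>) \<le> real q ^ ((t + 1) * d) * y"
proof -
  have sub: "\<F> \<subseteq> def \<F> T t \<union> (\<Union>E\<in>between {0} T t. fam \<F> E)"
  proof
    fix F assume F: "F \<in> \<F>"
    show "F \<in> def \<F> T t \<union> (\<Union>E\<in>between {0} T t. fam \<F> E)"
    proof (cases "dim (F \<inter> T) < t")
      case True
      then show ?thesis using F by (simp add: deficient_def)
    next
      case False
      moreover have "subspace F" using F \<F> by (auto simp: mem_Sub)
      then have "subspace (F \<inter> T)" using T by (simp add: subspace_inter)
      ultimately obtain E where "subspace E" "E \<subseteq> F \<inter> T" "dim E = t"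
        using choose_subspace_of_subspace[of t "F \<inter> T"] by (metis not_less span_eq_iff)
      then have "E \<in> between {0} T t" "F \<in> fam \<F> E"
        using F subspace_0 by (auto simp: between_def fam_def)
      then show ?thesis by blast
    qed
  qed
  have "real (card \<F>) \<le> y + (real q ^ ((t + 1) * d) - 1) * y"
    by (rule real_card_union_bound[OF sub])
      (use assms card_subspaces_less[OF T] in \<open>auto simp: between_def intro: order_trans[OF of_nat_0_le_iff]\<close>)
  then show ?thesis by (simp add: algebra_simps)
qed

text \<open>\<open>t + d\<close> is the least dimension of a space meeting every member of \<open>\<F>\<close> in dimension at
  least \<open>t\<close>, capped at \<open>k\<close>.\<close>

lemma covering_number:
  assumes \<F>: "\<F> \<subseteq> Sub" "\<F> \<noteq> {}" and \<G>: "\<G> \<subseteq> Sub" "\<G> \<noteq> {}"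
    and few: "\<And>G. G \<in> \<G> \<Longrightarrow> card (def \<F> G t) \<le> s"
  obtains d where "t + d \<le> k"
    and "\<And>T. subspace T \<Longrightarrow> dim T < t + d \<Longrightarrow> \<exists>F\<in>\<F>. dim (F \<inter> T) < t"
    and "d = 0 \<Longrightarrow> \<exists>E. subspace E \<and> dim E = t \<and> (\<forall>F\<in>\<F>. E \<subseteq> F)"
    and "\<And>y. real s \<le> y \<Longrightarrow> (\<And>E. subspace E \<Longrightarrow> dim E = t \<Longrightarrow> real (card (fam \<F> E)) \<le> y) \<Longrightarrow>
      real (card \<F>) \<le> real q ^ ((t + 1) * d) * y"
proof -
  define P where "P m \<longleftrightarrow> (\<exists>T. subspace T \<and> dim T = m \<and> (\<forall>F\<in>\<F>. t \<le> dim (F \<inter> T)))" for m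
  have "t \<le> dim (F \<inter> UNIV)" if "F \<in> \<F>" for F
    using that \<F> k_ge by (auto simp: mem_Sub)
  then have "P n" unfolding P_def using dim_space by (intro exI[of _ UNIV]) auto
  define m where "m = (LEAST m. P m)"
  have "P m" unfolding m_def using \<open>P n\<close> by (rule LeastI)
  have least: "\<not> P m'" if "m' < m" for m' using that unfolding m_def by (rule not_less_Least)
  obtain T where T: "subspace T" "dim T = m" "\<forall>F\<in>\<F>. t \<le> dim (F \<inter> T)"
    using \<open>P m\<close> unfolding P_def by blast
  have "t \<le> m"
  proof -
    obtain F where "F \<in> \<F>" using \<F> by blast
    then have "t \<le> dim (F \<inter> T)" using T by blast
    also have "\<dots> \<le> dim T" by (rule dim_subset) simp
    finally show ?thesis using T by simp
  qed
  show ?thesis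
  proof (cases "m \<le> k")
    case True
    show ?thesis
    proof (rule that[of "m - t"])
      show "t + (m - t) \<le> k" using True \<open>t \<le> m\<close> by simp
      show "\<exists>F\<in>\<F>. dim (F \<inter> T') < t" if "subspace T'" "dim T' < t + (m - t)" for T'
        using least[of "dim T'"] that \<open>t \<le> m\<close> unfolding P_def by (auto simp: not_le)
      have E: "T \<subseteq> F" if "m = t" "F \<in> \<F>" for F
      proof -
        have "subspace F" using that \<F> by (auto simp: mem_Sub)
        then have "F \<inter> T = T"
          using that T by (intro subspace_dim_equal) (auto simp: subspace_inter)
        then show ?thesis by blast
      qed
      then show "\<exists>E. subspace E \<and> dim E = t \<and> (\<forall>F\<in>\<F>. E \<subseteq> F)" if "m - t = 0"
        using T that \<open>t \<le> m\<close> by (intro exI[of _ T]) auto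
      show "real (card \<F>) \<le> real q ^ ((t + 1) * (m - t)) * y"
        if y: "real s \<le> y" "\<And>E. subspace E \<Longrightarrow> dim E = t \<Longrightarrow> real (card (fam \<F> E)) \<le> y" for y
      proof (cases "m = t")
        case True
        then have "fam \<F> T = \<F>" using E by (auto simp: fam_def)
        then show ?thesis using y(2)[of T] T True by simp
      next
        case False
        have "def \<F> T t = {}" using T by (auto simp: deficient_def not_less)
        then show ?thesis using card_le_of_cover[of \<F> T "m - t" y] \<F> T y False \<open>t \<le> m\<close> by simp
      qed
    qed
  next
    case False
    \<comment> \<open>The least exact cover has dimension above \<open>k\<close>. A member
      \<open>G\<close> of the other family, of dimension \<open>k\<close>, covers all but
      \<open>s\<close> members of \<open>\<F>\<close> and replaces it.\<close>
    obtain G where G: "G \<in> \<G>" using \<G> by blast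
    then have sG: "subspace G" "dim G = k" using \<G> by (auto simp: mem_Sub)
    show ?thesis
    proof (rule that[of "k - t"])
      show "t + (k - t) \<le> k" using k_ge by simp
      show "\<exists>F\<in>\<F>. dim (F \<inter> T') < t" if "subspace T'" "dim T' < t + (k - t)" for T'
        using least[of "dim T'"] that False k_ge unfolding P_def by (auto simp: not_le)
      show "\<exists>E. subspace E \<and> dim E = t \<and> (\<forall>F\<in>\<F>. E \<subseteq> F)" if "k - t = 0"
        using that k_ge by simp
      show "real (card \<F>) \<le> real q ^ ((t + 1) * (k - t)) * y"
        if y: "real s \<le> y" "\<And>E. subspace E \<Longrightarrow> dim E = t \<Longrightarrow> real (card (fam \<F> E)) \<le> y" for y
        using card_le_of_cover[of \<F> G "k - t" y] \<F> sG y few[OF G] k_ge by simp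
    qed
  qed
qed

section \<open>Numerical consequences of the lower bound on \<open>n\<close>\<close>

lemma N_ge_1: "j \<le> k \<Longrightarrow> 1 \<le> N j"
proof (induction "k - j" arbitrary: j)
  case (Suc x)
  then have "j < k" by simp
  have "1 \<le> N (Suc j)" using Suc by simp
  moreover have "1 \<le> real q ^ (n - k)" using q_real by (intro one_le_power) simp
  ultimately have "1 * 1 \<le> real q ^ (n - k) * N (Suc j)" by (intro mult_mono) auto
  then show ?case using N_Suc_le[OF \<open>j < k\<close>] by simp
qed simp

text \<open>Here \<open>q_pow_n\<close> enters. Both \<open>s\<close> and \<open>N (Suc j)\<close>
  are at least 1, so their maximum is at most their product, and the factor \<open>s\<close> in
  \<open>q_pow_n\<close> pays for it.\<close>

lemma max_s_N_le:
  assumes "j < k"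
  shows "13 * real q ^ (2 * k + 3 * t + 1) * max (real s) (N (Suc j)) \<le> N j"
proof -
  let ?Q = "real q ^ (2 * k + 3 * t + 1)"
  have s1: "1 \<le> real s" using s_pos by simp
  have N1: "1 \<le> N (Suc j)" using assms by (intro N_ge_1) simp
  have "13 * ?Q * max (real s) (N (Suc j)) \<le> 13 * ?Q * (real s * N (Suc j))"
    using s1 N1 by (intro mult_left_mono) (auto simp: max_def mult_le_cancel_left1 mult_le_cancel_right1)
  also have "\<dots> = 13 * real s * ?Q * N (Suc j)" by simp
  also have "\<dots> \<le> real q ^ (n - k) * N (Suc j)" using q_pow_n N1 by (intro mult_right_mono) auto
  also have "\<dots> \<le> N j" by (rule N_Suc_le[OF assms])
  finally show ?thesis .
qed

lemma N_small_mult: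
  assumes "j < k" "i \<le> 2 * k + 3 * t + 1"
  shows "13 * real q ^ i * real s \<le> N j" "13 * real q ^ i * N (Suc j) \<le> N j"
    "13 * real q ^ i * max (real s) (N (Suc j)) \<le> N j"
proof -
  have *: "13 * real q ^ i * max (real s) (N (Suc j)) \<le> N j"
    using q_pow_mono[OF assms(2)] max_s_N_le[OF assms(1)]
    by (elim order_trans[rotated]) (intro mult_right_mono mult_left_mono, auto)
  then show "13 * real q ^ i * max (real s) (N (Suc j)) \<le> N j" .
  have "13 * real q ^ i * real s \<le> 13 * real q ^ i * max (real s) (N (Suc j))"
    "13 * real q ^ i * N (Suc j) \<le> 13 * real q ^ i * max (real s) (N (Suc j))"
    by (auto intro!: mult_left_mono)
  with * show "13 * real q ^ i * real s \<le> N j" "13 * real q ^ i * N (Suc j) \<le> N j" by linarith+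
qed

lemma s_le_N: "j < k \<Longrightarrow> real s \<le> N j"
  using N_small_mult(1)[of j 0] by simp

text \<open>For excesses \<open>a\<close> and \<open>b\<close> of the two covering numbers over
  \<open>t\<close>, the product of the sizes is at most \<open>\<Phi> a * \<Phi> b\<close>: one
  cover costs q^((t+1)a) and branching the other family over \<open>a\<close> levels costs q^(ka).
  The maximum with \<open>s\<close> accounts for the exceptions, which may outnumber
  \<open>N (t + d)\<close> at the bottom level.\<close>

definition \<Phi> :: "nat \<Rightarrow> real" where
  "\<Phi> d = real q ^ ((t + 1 + k) * d) * max (real s) (N (t + d))"

lemma \<Phi>_nonneg: "0 \<le> \<Phi> d"
  by (auto simp: \<Phi>_def)

lemma \<Phi>_0: "\<Phi> 0 = N t"
  using s_le_N[of t] k_ge by (simp add: \<Phi>_def)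

lemma \<Phi>_1: "\<Phi> 1 = real q ^ (t + 1 + k) * N (t + 1)"
  using s_le_N[of "t + 1"] k_ge by (simp add: \<Phi>_def max_def)

text \<open>One more level costs q^(t+1+k), but the maximum falls by 13 q^(2k+3t+1); a gain of 13
  q^(k+2t) remains.\<close>

lemma \<Phi>_Suc:
  assumes "t + Suc d \<le> k"
  shows "13 * real q ^ (k + 2 * t) * \<Phi> (Suc d) \<le> \<Phi> d"
proof -
  have e: "(k + 2 * t) + (t + 1 + k) * Suc d = (t + 1 + k) * d + (2 * k + 3 * t + 1)" by simp
  have "13 * real q ^ (k + 2 * t) * \<Phi> (Suc d)
      = 13 * real q ^ ((k + 2 * t) + (t + 1 + k) * Suc d) * max (real s) (N (Suc (t + d)))"
    unfolding \<Phi>_def power_add by simp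
  also have "\<dots> = real q ^ ((t + 1 + k) * d) *
      (13 * real q ^ (2 * k + 3 * t + 1) * max (real s) (N (Suc (t + d))))"
    unfolding e power_add by simp
  also have "\<dots> \<le> real q ^ ((t + 1 + k) * d) * max (real s) (N (t + d))"
    using max_s_N_le[of "t + d"] assms by (intro mult_left_mono) auto
  finally show ?thesis by (simp add: \<Phi>_def)
qed

lemma \<Phi>_Suc_le:
  assumes "t + Suc d \<le> k"
  shows "\<Phi> (Suc d) \<le> \<Phi> d"
proof -
  have "1 \<le> real q ^ (k + 2 * t)" using q_real by (intro one_le_power) simp
  then have "1 * \<Phi> (Suc d) \<le> 13 * real q ^ (k + 2 * t) * \<Phi> (Suc d)"
    using \<Phi>_nonneg by (intro mult_right_mono) auto
  then show ?thesis using \<Phi>_Suc[OF assms] by simp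
qed

lemma \<Phi>_antimono: "i \<le> d \<Longrightarrow> t + d \<le> k \<Longrightarrow> \<Phi> d \<le> \<Phi> i"
proof (induction d)
  case (Suc d)
  then show ?case using \<Phi>_Suc_le[of d] by (cases "i = Suc d") auto
qed simp

text \<open>The gain q^(k+2t) from level 1 to level 2 outweighs the factor q^(t+1+k) in
  \<open>\<Phi> 1\<close>, because \<open>t\<close> is at least 1.\<close>

lemma \<Phi>_ge_2:
  assumes "2 \<le> d" "t + d \<le> k"
  shows "13 * \<Phi> d \<le> N (t + 1)"
proof -
  have "13 * real q ^ (k + 2 * t) * \<Phi> 2 \<le> real q ^ (t + 1 + k) * N (t + 1)"
    using \<Phi>_Suc[of 1] \<Phi>_1 assms by (simp add: numeral_2_eq_2)
  also have "\<dots> \<le> real q ^ (k + 2 * t) * N (t + 1)"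
    using N_pos[of "t + 1"] k_ge t_pos by (intro mult_right_mono q_pow_mono) auto
  finally have "real q ^ (k + 2 * t) * (13 * \<Phi> 2) \<le> real q ^ (k + 2 * t) * N (t + 1)" by simp
  then have "13 * \<Phi> 2 \<le> N (t + 1)" by (simp only: mult_le_cancel_left_pos q_pow_pos)
  then show ?thesis using \<Phi>_antimono[of 2 d] assms by simp
qed

section \<open>Sizes of the pieces of the extremal pair\<close>

definition h2 :: real where
  "h2 = (\<Prod>i<k - t. (real q ^ n - real q ^ (Suc k + i)) / (real q ^ k - real q ^ (t + i)))"

text \<open>The number of hyperplanes of a (k+1)-space \<open>X\<close> that do not contain a given
  \<open>t\<close>-space in \<open>X\<close>; see \<open>card_hyperplanes_avoiding\<close>.\<close>

definition hB :: real where
  "hB = real q ^ (k - t + 1) * ((real q ^ t - 1) / (real q - 1))"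

text \<open>The number of (t+1)-spaces between a \<open>t\<close>-space \<open>E\<close> and a
  (k+1)-space \<open>X\<close>.\<close>

definition p :: real where
  "p = (real q ^ (k - t + 1) - 1) / (real q - 1)"

text \<open>\<open>h2\<close> is the size of \<open>H2 X E k\<close> in the raw form of
  \<open>card_H2\<close>. In each of the \<open>k - t\<close> factors q^(t+i) cancels and q^(k-t+1)
  comes out.\<close>

lemma h2_eq_gauss_binom:
  "h2 = real q ^ ((k - t) * (k - t + 1)) * gauss_binom q (int n - int k - 1) (int k - int t)"
proof -
  have nat: "nat (int k - int t) = k - t" by simp
  have "(real q ^ n - real q ^ (Suc k + i)) / (real q ^ k - real q ^ (t + i))
    = real q ^ (k - t + 1) * ((real q powi (int n - int k - 1 - int i) - 1) / (real q powi (int k - int t - int i) - 1))"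
    if i: "i < k - t" for i
  proof -
    have "int n - int k - 1 - int i = int (n - (Suc k + i))" "int k - int t - int i = int (k - (t + i))"
      using i n_ge k_ge by linarith+
    then have P: "real q powi (int n - int k - 1 - int i) = real q ^ (n - (Suc k + i))"
      "real q powi (int k - int t - int i) = real q ^ (k - (t + i))"
      by (simp_all only: power_int_of_nat)
    have A: "real q ^ n = real q ^ (Suc k + i) * real q ^ (n - (Suc k + i))"
      "real q ^ k = real q ^ (t + i) * real q ^ (k - (t + i))"
      using i n_ge k_ge by (simp_all flip: power_add del: power_Suc add_Suc)
    have B: "real q ^ (Suc k + i) = real q ^ (t + i) * real q ^ (k - t + 1)"
      using i k_ge by (simp flip: power_add del: power_Suc add: algebra_simps)
    have "(real q ^ n - real q ^ (Suc k + i)) = real q ^ (t + i) * (real q ^ (k - t + 1) * (real q ^ (n - (Suc k + i)) - 1))"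
      unfolding A(1) B by (simp only: algebra_simps)
    moreover have "real q ^ k - real q ^ (t + i) = real q ^ (t + i) * (real q ^ (k - (t + i)) - 1)"
      unfolding A(2) by (simp only: algebra_simps)
    ultimately show ?thesis unfolding P using q_pow_pos[of "t + i"] by (simp only:) simp
  qed
  then have "h2 = (\<Prod>i<k - t. real q ^ (k - t + 1) *
      ((real q powi (int n - int k - 1 - int i) - 1) / (real q powi (int k - int t - int i) - 1)))"
    unfolding h2_def by (intro prod.cong) auto
  also have "\<dots> = (real q ^ (k - t + 1)) ^ (k - t) * gauss_binom q (int n - int k - 1) (int k - int t)"
    unfolding prod.distrib gauss_binom_def nat using k_ge by (simp only: prod_constant card_lessThan) simp
  finally show ?thesis by (simp only: power_mult[symmetric] mult.commute)
qed

lemma hB_eq_gauss_binom: "hB = real q ^ (k - t + 1) * gauss_binom q (int t) 1"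
  by (simp add: hB_def gauss_binom_def)

lemma card_H2:
  assumes "subspace X" "dim X = k + 1" "subspace E" "dim E = t" "E \<subseteq> X"
  shows "real (card (ext X E UNIV k)) = h2"
  using real_card_ext[of E X UNIV "k - t"] assms k_ge by (simp add: h2_def dim_space)

lemma card_hyperplanes_avoiding:
  assumes "subspace X" "dim X = k + 1" "subspace E" "dim E = t" "E \<subseteq> X"
  shows "real (card (between {0} X k - between E X k)) = hB"
proof -
  have c1: "real (card (between {0} X k)) = (real q ^ Suc k - 1) / (real q - 1)"
    using card_between[of "{0}" X k] assms subspace_0[of X] gb_hyperplane[of k] by simp
  have "k + 1 - t = Suc (k - t)" using k_ge by simp
  then have c2: "real (card (between E X k)) = (real q ^ Suc (k - t) - 1) / (real q - 1)"
    using card_between[of E X "k - t"] assms gb_hyperplane[of "k - t"] k_ge by simp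
  have "between E X k \<subseteq> between {0} X k"
    by (auto simp: between_def subspace_0)
  then have "real (card (between {0} X k - between E X k)) =
      real (card (between {0} X k)) - real (card (between E X k))"
    by (simp add: card_Diff_subset of_nat_diff card_mono)
  also have "\<dots> = (real q ^ Suc k - real q ^ Suc (k - t)) / (real q - 1)"
    unfolding c1 c2 by (simp add: diff_divide_distrib)
  also have "real q ^ Suc k = real q ^ Suc (k - t) * real q ^ t"
    using k_ge by (simp flip: power_add)
  finally show ?thesis by (simp add: hB_def algebra_simps diff_divide_distrib)
qed

section \<open>Deficient pairs relative to a (k+1)-space\<close>

lemma hyperplane_Int:
  assumes "subspace X" "subspace G" "dim X = Suc (dim G)" "G \<subseteq> X" "subspace E" "E \<subseteq> X" "\<not> E \<subseteq> G"
  shows "Suc (dim (G \<inter> E)) = dim E" "span (G \<union> E) = X"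
proof -
  have sub: "span (G \<union> E) \<subseteq> X" using assms by (intro span_minimal) auto
  obtain v where v: "v \<in> E" "v \<notin> G" using assms by auto
  have "Suc (dim G) = dim (span (insert v G))" using dim_span_insert[of G v] v assms by simp
  also have "\<dots> \<le> dim (span (G \<union> E))" using v by (intro dim_subset span_mono) auto
  finally have ge: "dim X \<le> dim (span (G \<union> E))" using assms by simp
  then show eq: "span (G \<union> E) = X" using subspace_dim_equal[of "span (G \<union> E)" X] sub assms by blast
  show "Suc (dim (G \<inter> E)) = dim E" using dim_span_Un[of G E] assms unfolding eq by simp
qed

text \<open>The hyperplane \<open>G\<close> of \<open>X\<close> lowers by one the dimension of every
  subspace of \<open>X\<close> not inside it. So \<open>F \<inter> X = E\<close> leaves dimension
  \<open>t - 1\<close>, while a larger \<open>F \<inter> X\<close> leaves at least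
  \<open>t\<close>.\<close>

lemma deficient_iff:
  assumes X: "subspace X" "dim X = k + 1" and E: "subspace E" "dim E = t" "E \<subseteq> X"
    and G: "subspace G" "dim G = k" "G \<subseteq> X" "\<not> E \<subseteq> G"
    and F: "subspace F" "E \<subseteq> F"
  shows "dim (F \<inter> G) < t \<longleftrightarrow> F \<inter> X = E"
proof
  assume "F \<inter> X = E"
  then have "F \<inter> G = G \<inter> E" using G F E by auto
  then show "dim (F \<inter> G) < t" using hyperplane_Int(1)[of X G E] X E G by simp
next
  assume lt: "dim (F \<inter> G) < t"
  show "F \<inter> X = E"
  proof (rule ccontr)
    assume ne: "F \<inter> X \<noteq> E"
    have sFX: "subspace (F \<inter> X)" using F X by (simp add: subspace_inter)
    have gt: "t < dim (F \<inter> X)"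
    proof (rule ccontr)
      assume "\<not> t < dim (F \<inter> X)"
      then have "E = F \<inter> X" using subspace_dim_equal[of E "F \<inter> X"] E F sFX by auto
      then show False using ne by simp
    qed
    show False
    proof (cases "F \<inter> X \<subseteq> G")
      case True
      then have "dim (F \<inter> X) \<le> dim (F \<inter> G)" by (intro dim_subset) auto
      then show False using gt lt by simp
    next
      case False
      have "G \<inter> (F \<inter> X) = F \<inter> G" using G by auto
      then show False using hyperplane_Int(1)[of X G "F \<inter> X"] X G sFX gt lt False by simp
    qed
  qed
qed

text \<open>Used for lower bounds on \<open>ext X L UNIV m\<close>: the spaces containing more of
  \<open>X\<close> than \<open>L\<close> are comparatively rare.\<close>

lemma above_cover:
  assumes X: "subspace X" and L: "subspace L" "L \<subseteq> X"
  shows "between L UNIV m \<subseteq> ext X L UNIV m \<union> (\<Union>L'\<in>between L X (Suc (dim L)). between L' UNIV m)"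
proof
  fix F assume F: "F \<in> between L UNIV m"
  show "F \<in> ext X L UNIV m \<union> (\<Union>L'\<in>between L X (Suc (dim L)). between L' UNIV m)"
  proof (cases "F \<inter> X = L")
    case True
    then show ?thesis using F by (simp add: between_def ext_def)
  next
    case False
    then obtain v where v: "v \<in> F" "v \<in> X" "v \<notin> L" using F L by (auto simp: between_def)
    then have "span (insert v L) \<in> between L X (Suc (dim L))" "F \<in> between (span (insert v L)) UNIV m"
      using F L X dim_span_insert[of L v] span_superset[of "insert v L"]
        span_insert_subset[of X L v] span_insert_subset[of F L v]
      by (auto simp: between_def simp del: dim_span)
    then show ?thesis by blast
  qed
qed

lemma p_ge: "real q ^ (k - t) \<le> p"
proof -
  have "real q ^ (k - t) * (real q - 1) \<le> real q ^ (k - t + 1) - 1"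
    using one_le_power[of "real q" "k - t"] q_real by (simp add: algebra_simps)
  then show ?thesis using q_real by (simp add: p_def pos_le_divide_eq)
qed

lemma exists_flag:
  obtains X E where "subspace X" "dim X = k + 1" "subspace E" "dim E = t" "E \<subseteq> X"
proof -
  obtain X where X: "subspace X" "dim X = k + 1"
    using choose_subspace_of_subspace[of "k + 1" UNIV] n_ge dim_space by auto
  obtain E where "subspace E" "E \<subseteq> X" "dim E = t"
    using choose_subspace_of_subspace[of t X] X k_ge by (metis le_add1 le_trans span_eq_iff add_leD1)
  then show ?thesis using that X by blast
qed

text \<open>\<open>N t - h2\<close> counts the \<open>k\<close>-spaces above \<open>E\<close>
  meeting \<open>X\<close> in more than \<open>E\<close>. For the \<open>p\<close> spaces
  \<open>L\<close> between \<open>E\<close> and \<open>X\<close> of dimension t+1, the families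
  meeting \<open>X\<close> exactly in \<open>L\<close> are disjoint, and each keeps at least 12/13,
  hence 7/8, of \<open>N (t + 1)\<close>.\<close>

lemma h2_upper: "7 / 8 * p * N (t + 1) \<le> N t - h2"
proof -
  obtain X E where X: "subspace X" "dim X = k + 1" and E: "subspace E" "dim E = t" "E \<subseteq> X"
    by (rule exists_flag)
  let ?L = "between E X (Suc t)"
  have one: "7 / 8 * N (t + 1) \<le> real (card (ext X L UNIV k))" if "L \<in> ?L" for L
  proof -
    have L: "subspace L" "L \<subseteq> X" "dim L = t + 1" using that by (auto simp: between_def)
    have "real (card (between L UNIV k)) \<le> real (card (ext X L UNIV k)) + (real q ^ (k - t) - 1) * N (t + 2)"
    proof (rule real_card_union_bound[OF above_cover[OF X(1) L(1,2)] order_refl])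
      show "real (card (between L' UNIV k)) \<le> N (t + 2)" if "L' \<in> between L X (Suc (dim L))" for L'
        using that L card_above[of L'] k_ge by (auto simp: between_def)
      show "real (card (between L X (Suc (dim L)))) \<le> real q ^ (k - t) - 1"
        using L X k_ge by (intro card_points_le) auto
      show "0 \<le> N (t + 2)" using N_pos[of "t + 2"] k_ge by simp
    qed
    moreover have "13 * real q ^ (k - t) * N (t + 2) \<le> N (t + 1)"
      using N_small_mult(2)[of "t + 1" "k - t"] k_ge by simp
    moreover have "0 < N (t + 2)" "0 < N (t + 1)" using N_pos k_ge by auto
    ultimately show ?thesis using card_above[of L] L k_ge by (simp add: algebra_simps)
  qed
  have cL: "real (card ?L) = p"
    using card_points[of E X] E X k_ge by (simp add: p_def Suc_diff_le)
  have sub: "(\<Union>L\<in>?L. ext X L UNIV k) \<subseteq> between E UNIV k - ext X E UNIV k"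
    using E by (auto simp: ext_def between_def)
  have sub2: "ext X E UNIV k \<subseteq> between E UNIV k" by (auto simp: ext_def between_def)
  have "7 / 8 * p * N (t + 1) = (\<Sum>L\<in>?L. 7 / 8 * N (t + 1))" by (simp add: cL)
  also have "\<dots> \<le> (\<Sum>L\<in>?L. real (card (ext X L UNIV k)))" by (rule sum_mono) (rule one)
  also have "\<dots> = real (card (\<Union>L\<in>?L. ext X L UNIV k))"
    by (subst card_UN_disjoint) (auto simp: ext_def)
  also have "\<dots> \<le> real (card (between E UNIV k - ext X E UNIV k))"
    using sub by (simp add: card_mono)
  also have "\<dots> = N t - h2"
    using sub2 card_H2[OF X E] card_above[of E] E k_ge by (simp add: card_Diff_subset of_nat_diff card_mono)
  finally show ?thesis .
qed

text \<open>Makes room for the \<open>s\<close> members of \<open>H2\<close> kept in the extremal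
  family. At most \<open>N t / 13\<close> of the \<open>k\<close>-spaces above \<open>E\<close> meet
  \<open>X\<close> in more than \<open>E\<close>, and \<open>s\<close> is at most
  \<open>N t / 13\<close> as well.\<close>

lemma s_le_h2: "real s \<le> h2"
proof -
  obtain X E where X: "subspace X" "dim X = k + 1" and E: "subspace E" "dim E = t" "E \<subseteq> X"
    by (rule exists_flag)
  have "real (card (between E UNIV k)) \<le> real (card (ext X E UNIV k)) + (real q ^ (k + 1) - 1) * N (t + 1)"
  proof (rule real_card_union_bound[OF above_cover[OF X(1) E(1,3)] order_refl])
    show "real (card (between L' UNIV k)) \<le> N (t + 1)" if "L' \<in> between E X (Suc (dim E))" for L'
      using that E card_above[of L'] k_ge by (auto simp: between_def)
    show "real (card (between E X (Suc (dim E)))) \<le> real q ^ (k + 1) - 1"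
      using E X k_ge by (intro card_points_le) auto
    show "0 \<le> N (t + 1)" using N_pos[of "t + 1"] k_ge by simp
  qed
  moreover have "13 * real q ^ (k + 1) * N (t + 1) \<le> N t"
    using N_small_mult(2)[of t "k + 1"] k_ge by simp
  moreover have "13 * real s \<le> N t" using N_small_mult(1)[of t 0] k_ge by simp
  moreover have "0 < N (t + 1)" using N_pos k_ge by auto
  ultimately show ?thesis using card_above[of E] E k_ge card_H2[OF X E] by (simp add: algebra_simps)
qed

section \<open>The extremal pair and the reduction to a common subspace\<close>

lemma dim_Int_common:
  assumes "subspace F" "subspace G" "E \<subseteq> F" "E \<subseteq> G" "dim E = t"
  shows "\<not> dim (F \<inter> G) < t"
  using assms dim_subset[of E "F \<inter> G"] by auto

lemma hB_pos: "0 < hB"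
  using q_real q_pow_gt_1[OF t_pos] by (simp add: hB_def)

lemma admissible_pair_iff:
  "admissible_pair scale k s t \<F> \<G> \<longleftrightarrow> \<F> \<subseteq> Sub \<and> \<G> \<subseteq> Sub \<and>
    (\<forall>F\<in>\<F>. card (def \<G> F t) \<le> s) \<and> (\<forall>G\<in>\<G>. card (def \<F> G t) \<le> s) \<and>
    (\<exists>F\<in>\<F>. \<exists>G\<in>\<G>. dim (F \<inter> G) < t)"
  by (auto simp: admissible_pair_def Sub_def almost_cross_intersecting_def cross_intersecting_def not_le)

text \<open>All but \<open>s\<close> members of \<open>H2\<close> are removed from the first copy of
  the star of \<open>E\<close>, and \<open>\<B>\<close> is added to the second. By
  \<open>deficient_iff\<close> the deficient pairs are exactly those of \<open>\<S>\<close> with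
  \<open>\<B>\<close>.\<close>

lemma construction:
  obtains \<F> \<G> where "admissible_pair scale k s t \<F> \<G>"
    "real (card \<F>) = N t - h2 + real s" "real (card \<G>) = N t + min (real s) hB"
proof -
  obtain X E where X: "subspace X" "dim X = k + 1" and E: "subspace E" "dim E = t" "E \<subseteq> X"
    by (rule exists_flag)
  let ?H = "between E UNIV k" and ?H2 = "ext X E UNIV k" and ?B = "between {0} X k - between E X k"
  have "s \<le> card ?H2" using s_le_h2 card_H2[OF X E] by simp
  then obtain \<S> where \<S>: "\<S> \<subseteq> ?H2" "card \<S> = s" by (meson obtain_subset_with_card_n)
  obtain \<B> where \<B>: "\<B> \<subseteq> ?B" "card \<B> = min s (card ?B)"
    by (meson obtain_subset_with_card_n min.cobounded2)
  have cB: "real (card \<B>) = min (real s) hB"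
    using \<B> card_hyperplanes_avoiding[OF X E] by (simp add: of_nat_min)
  define \<F> where "\<F> = (?H - ?H2) \<union> \<S>"
  define \<G> where "\<G> = ?H \<union> \<B>"
  have H2H: "?H2 \<subseteq> ?H" by (auto simp: ext_def between_def)
  have cH: "real (card ?H) = N t" using card_above[of E] E k_ge by simp
  have "card \<F> = card (?H - ?H2) + card \<S>" unfolding \<F>_def using \<S> by (intro card_Un_disjoint) auto
  moreover have "real (card (?H - ?H2)) = N t - h2"
    using H2H cH card_H2[OF X E] by (simp add: card_Diff_subset of_nat_diff card_mono)
  ultimately have c\<F>: "real (card \<F>) = N t - h2 + real s" using \<S> by simp
  have "?H \<inter> \<B> = {}" using \<B> by (auto simp: between_def)
  then have c\<G>: "real (card \<G>) = N t + min (real s) hB"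
    unfolding \<G>_def using cH cB by (simp add: card_Un_disjoint)
  have F: "subspace F" "E \<subseteq> F" "dim F = k" "F \<inter> X = E \<Longrightarrow> F \<in> \<S>" if "F \<in> \<F>" for F
    using that \<S> H2H by (auto simp: \<F>_def between_def ext_def)
  have G: "subspace G" "dim G = k" "E \<subseteq> G \<or> G \<in> \<B>" if "G \<in> \<G>" for G
    using that \<B> by (auto simp: \<G>_def between_def)
  have B: "G \<subseteq> X" "\<not> E \<subseteq> G" "subspace G" "dim G = k" if "G \<in> \<B>" for G
    using that \<B> by (auto simp: between_def)
  have iff: "dim (F \<inter> G) < t \<longleftrightarrow> F \<inter> X = E" if "F \<in> \<F>" "G \<in> \<B>" for F G
    by (rule deficient_iff[OF X E]) (use F[OF that(1)] B[OF that(2)] in auto)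
  have "card (def \<G> F t) \<le> s" if "F \<in> \<F>" for F
  proof -
    have "G \<in> \<B>" if "G \<in> def \<G> F t" for G
      using that dim_Int_common[of G F E] F[OF \<open>F \<in> \<F>\<close>] G[of G] E(2) by (auto simp: deficient_def)
    then have "def \<G> F t \<subseteq> \<B>" by blast
    then have "card (def \<G> F t) \<le> card \<B>" by (simp add: card_mono)
    then show ?thesis using \<B> by simp
  qed
  moreover have "card (def \<F> G t) \<le> s" if "G \<in> \<G>" for G
  proof -
    have "F \<in> \<S>" if "F \<in> def \<F> G t" for F
      using that dim_Int_common[of F G E] F[of F] G[OF \<open>G \<in> \<G>\<close>] E(2) iff[of F G]
      by (auto simp: deficient_def)
    then have "def \<F> G t \<subseteq> \<S>" by blast
    then show ?thesis using \<S> card_mono[of \<S> "def \<F> G t"] by simp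
  qed
  moreover have "\<exists>F\<in>\<F>. \<exists>G\<in>\<G>. dim (F \<inter> G) < t"
  proof -
    have "\<S> \<noteq> {}" using \<S> s_pos by auto
    then obtain F where F: "F \<in> \<S>" by auto
    have "0 < real (card \<B>)" using cB s_pos hB_pos by simp
    then have "\<B> \<noteq> {}" by auto
    then obtain G where "G \<in> \<B>" by auto
    moreover have "F \<in> \<F>" "F \<inter> X = E" using F \<S> by (auto simp: \<F>_def ext_def)
    ultimately show ?thesis using iff by (auto simp: \<G>_def)
  qed
  ultimately have "admissible_pair scale k s t \<F> \<G>"
    unfolding admissible_pair_iff using F G by (auto simp: mem_Sub)
  then show ?thesis using that c\<F> c\<G> by blast
qed

text \<open>Maximality enters only as this comparison with the pair of \<open>construction\<close>;
  the condition is symmetric in the two families.\<close>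

definition optimal :: "'b set set \<Rightarrow> 'b set set \<Rightarrow> bool" where
  "optimal \<F> \<G> \<longleftrightarrow> admissible_pair scale k s t \<F> \<G> \<and>
    (N t - h2 + real s) * (N t + min (real s) hB) \<le> real (card \<F>) * real (card \<G>)"

lemma optimal_swap: "optimal \<F> \<G> \<Longrightarrow> optimal \<G> \<F>"
  unfolding optimal_def admissible_pair_iff by (metis Int_commute mult.commute)

lemma p_ge_4: "4 \<le> p"
proof -
  have "real q ^ 2 \<le> real q ^ (k - t)" using k_ge by (intro q_pow_mono) simp
  moreover have "2 * 2 \<le> real q * real q" using q_real by (intro mult_mono) auto
  ultimately show ?thesis using p_ge by (simp add: power2_eq_square)
qed

text \<open>The threshold with which later upper bounds are compared: the first factor comes from
  \<open>h2_upper\<close>, the second is at least \<open>N t\<close>.\<close>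

lemma optimal_large:
  assumes "optimal \<F> \<G>"
  shows "7 / 8 * p * N (t + 1) * N t < real (card \<F>) * real (card \<G>)"
proof -
  have "0 < N t" using N_pos k_ge by simp
  have "7 / 8 * p * N (t + 1) < N t - h2 + real s" using h2_upper s_pos by simp
  then have "7 / 8 * p * N (t + 1) * N t < (N t - h2 + real s) * N t"
    using \<open>0 < N t\<close> by (rule mult_strict_right_mono)
  also have "\<dots> \<le> (N t - h2 + real s) * (N t + min (real s) hB)"
  proof (rule mult_left_mono)
    have "0 \<le> 7 / 8 * p * N (t + 1)" using p_ge_4 N_pos[of "t + 1"] k_ge by simp
    then show "0 \<le> N t - h2 + real s" using h2_upper by simp
  qed (use hB_pos in simp)
  also have "\<dots> \<le> real (card \<F>) * real (card \<G>)" using assms by (simp add: optimal_def)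
  finally show ?thesis .
qed

lemma optimal_not_small:
  assumes "optimal \<F> \<G>" "13 * (real (card \<F>) * real (card \<G>)) \<le> N (t + 1) * N t"
  shows False
proof -
  have pos: "0 < N (t + 1) * N t" using N_pos k_ge by simp
  have "N (t + 1) * N t \<le> 7 / 8 * p * (N (t + 1) * N t)"
    using mult_right_mono[of 1 "7 / 8 * p" "N (t + 1) * N t"] pos p_ge_4 by simp
  then have "N (t + 1) * N t < real (card \<F>) * real (card \<G>)"
    using optimal_large[OF assms(1)] by (simp add: mult.assoc)
  then show False using assms(2) pos by linarith
qed

text \<open>\<open>a\<close> and \<open>b\<close> are the excesses from
  \<open>covering_number\<close>. The cases \<open>2 \<le> a\<close>, \<open>2 \<le> b\<close> and
  \<open>a = b = 1\<close> make the product too small. The size bound on the other family is kept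
  for \<open>F_not_small\<close>.\<close>

lemma optimal_dichotomy:
  assumes "optimal \<F> \<G>"
  shows "(\<exists>E. subspace E \<and> dim E = t \<and> (\<forall>F\<in>\<F>. E \<subseteq> F)) \<and> real (card \<G>) \<le> real q ^ (t + 1) * N t \<or>
    (\<exists>E. subspace E \<and> dim E = t \<and> (\<forall>G\<in>\<G>. E \<subseteq> G)) \<and> real (card \<F>) \<le> real q ^ (t + 1) * N t"
proof -
  have sub: "\<F> \<subseteq> Sub" "\<G> \<subseteq> Sub" and ne: "\<F> \<noteq> {}" "\<G> \<noteq> {}"
    and few: "\<And>F. F \<in> \<F> \<Longrightarrow> card (def \<G> F t) \<le> s" "\<And>G. G \<in> \<G> \<Longrightarrow> card (def \<F> G t) \<le> s"
    using assms unfolding optimal_def admissible_pair_iff by auto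
  obtain a where a: "t + a \<le> k"
    "\<And>T. subspace T \<Longrightarrow> dim T < t + a \<Longrightarrow> \<exists>F\<in>\<F>. dim (F \<inter> T) < t"
    "a = 0 \<Longrightarrow> \<exists>E. subspace E \<and> dim E = t \<and> (\<forall>F\<in>\<F>. E \<subseteq> F)"
    "\<And>y. real s \<le> y \<Longrightarrow> (\<And>E. subspace E \<Longrightarrow> dim E = t \<Longrightarrow> real (card (fam \<F> E)) \<le> y) \<Longrightarrow>
      real (card \<F>) \<le> real q ^ ((t + 1) * a) * y"
    using covering_number[OF sub(1) ne(1) sub(2) ne(2) few(2)] by blast
  obtain b where b: "t + b \<le> k"
    "\<And>T. subspace T \<Longrightarrow> dim T < t + b \<Longrightarrow> \<exists>G\<in>\<G>. dim (G \<inter> T) < t"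
    "b = 0 \<Longrightarrow> \<exists>E. subspace E \<and> dim E = t \<and> (\<forall>G\<in>\<G>. E \<subseteq> G)"
    "\<And>y. real s \<le> y \<Longrightarrow> (\<And>E. subspace E \<Longrightarrow> dim E = t \<Longrightarrow> real (card (fam \<G> E)) \<le> y) \<Longrightarrow>
      real (card \<G>) \<le> real q ^ ((t + 1) * b) * y"
    using covering_number[OF sub(2) ne(2) sub(1) ne(1) few(1)] by blast
  have sle: "real s \<le> real q ^ (k * d) * max (real s) (N (t + d))" for d
  proof -
    have "1 * real s \<le> real q ^ (k * d) * max (real s) (N (t + d))"
      using q_real by (intro mult_mono one_le_power) auto
    then show ?thesis by simp
  qed
  \<comment> \<open>The cover of \<open>\<F>\<close> costs the first factor; each
    \<open>t\<close>-space in it is then branched over \<open>b\<close> levels, since no space of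
    dimension below \<open>t + b\<close> covers \<open>\<G>\<close>.\<close>
  have c\<F>: "real (card \<F>) \<le> real q ^ ((t + 1) * a) * (real q ^ (k * b) * max (real s) (N (t + b)))"
  proof (rule a(4)[OF sle])
    fix E assume E: "subspace E" "dim E = t"
    show "real (card (fam \<F> E)) \<le> real q ^ (k * b) * max (real s) (N (t + b))"
      using branching[OF sub few(2) E(1), of b] b(1,2) unfolding E(2) by blast
  qed
  have c\<G>: "real (card \<G>) \<le> real q ^ ((t + 1) * b) * (real q ^ (k * a) * max (real s) (N (t + a)))"
  proof (rule b(4)[OF sle])
    fix E assume E: "subspace E" "dim E = t"
    show "real (card (fam \<G> E)) \<le> real q ^ (k * a) * max (real s) (N (t + a))"
      using branching[OF sub(2,1) few(1) E(1), of a] a(1,2) unfolding E(2) by blast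
  qed
  have N_le: "real q ^ ((t + 1) * d) * (real q ^ (k * 0) * max (real s) (N (t + 0))) \<le> real q ^ (t + 1) * N t"
    if "d \<le> 1" for d
  proof -
    have "max (real s) (N (t + 0)) = N t" using s_le_N[of t] k_ge by simp
    moreover have "real q ^ ((t + 1) * d) \<le> real q ^ (t + 1)"
    proof (rule q_pow_mono)
      show "(t + 1) * d \<le> t + 1" using mult_le_mono2[OF that, of "t + 1"] by simp
    qed
    ultimately show ?thesis using N_pos[of t] k_ge by (simp add: mult_right_mono)
  qed
  have "real (card \<F>) * real (card \<G>) \<le>
      (real q ^ ((t + 1) * a) * (real q ^ (k * b) * max (real s) (N (t + b)))) *
      (real q ^ ((t + 1) * b) * (real q ^ (k * a) * max (real s) (N (t + a))))"
    using c\<F> c\<G> by (intro mult_mono) auto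
  also have "\<dots> = \<Phi> a * \<Phi> b"
    unfolding \<Phi>_def add_mult_distrib power_add by (simp only: mult_ac)
  finally have prod: "real (card \<F>) * real (card \<G>) \<le> \<Phi> a * \<Phi> b" .
  have Npos: "0 < N t" "0 < N (t + 1)" using N_pos k_ge by auto
  have \<Phi>0: "\<Phi> a \<le> N t" "\<Phi> b \<le> N t"
    using \<Phi>_antimono[of 0] \<Phi>_0 a(1) b(1) by auto
  have "\<not> 2 \<le> a"
  proof
    assume "2 \<le> a"
    then have "13 * \<Phi> a * \<Phi> b \<le> N (t + 1) * N t"
      using \<Phi>_ge_2[of a] a(1) \<Phi>0 \<Phi>_nonneg Npos by (intro mult_mono) auto
    then show False using optimal_not_small[OF assms] prod by simp
  qed
  moreover have "\<not> 2 \<le> b"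
  proof
    assume "2 \<le> b"
    then have "13 * \<Phi> b * \<Phi> a \<le> N (t + 1) * N t"
      using \<Phi>_ge_2[of b] b(1) \<Phi>0 \<Phi>_nonneg Npos by (intro mult_mono) auto
    then show False using optimal_not_small[OF assms] prod by (simp add: mult_ac)
  qed
  moreover have "\<not> (a = 1 \<and> b = 1)"
  proof
    assume "a = 1 \<and> b = 1"
    then have "real (card \<F>) * real (card \<G>) \<le> \<Phi> 1 * \<Phi> 1" using prod by simp
    also have "\<dots> = real q ^ ((t + 1 + k) + (t + 1 + k)) * N (t + 1) * N (t + 1)"
      unfolding \<Phi>_1 power_add by (simp add: mult_ac)
    finally have "13 * (real (card \<F>) * real (card \<G>)) \<le>
        (13 * real q ^ ((t + 1 + k) + (t + 1 + k)) * N (Suc t)) * N (t + 1)" by simp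
    \<comment> \<open>The exponent 2(k+t+1) is at most 2k+3t+1 because \<open>t\<close> is at least
      1.\<close>
    also have "\<dots> \<le> N t * N (t + 1)"
      using N_small_mult(2)[of t "(t + 1 + k) + (t + 1 + k)"] k_ge t_pos Npos by (intro mult_right_mono) auto
    finally show False using optimal_not_small[OF assms] by (simp add: mult.commute)
  qed
  ultimately have "a = 0 \<and> b \<le> 1 \<or> b = 0 \<and> a \<le> 1" by arith
  then show ?thesis
  proof
    assume "a = 0 \<and> b \<le> 1"
    then show ?thesis using a(3) c\<G> N_le[of b] by (meson order_trans)
  next
    assume "b = 0 \<and> a \<le> 1"
    then show ?thesis using b(3) c\<F> N_le[of a] by (meson order_trans)
  qed
qed

section \<open>Pairs with a common subspace on one side\<close>

text \<open>Enlarging \<open>T\<close> raises the dimension of its intersection with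
  \<open>G\<close> by at most the dimension added.\<close>

lemma dim_Int_superspace_le:
  assumes "subspace T" "subspace T'" "T \<subseteq> T'" "subspace G"
  shows "dim (G \<inter> T') + dim T \<le> dim (G \<inter> T) + dim T'"
proof -
  have "(G \<inter> T') \<inter> T = G \<inter> T" using assms by auto
  moreover have "dim (span (G \<inter> T' \<union> T)) \<le> dim T'"
    using assms by (intro dim_subset span_minimal) auto
  ultimately show ?thesis
    using dim_span_Un[of "G \<inter> T'" T] assms subspace_inter[of G T'] by simp
qed

lemma nested_union_bound:
  fixes \<T> :: "'b set set" and \<U> \<B> :: "'b set \<Rightarrow> 'b set set"
  assumes "\<And>T. T \<in> \<T> \<Longrightarrow> real (card (\<U> T)) \<le> c" "real (card \<T>) \<le> b"
    and "\<And>T U. T \<in> \<T> \<Longrightarrow> U \<in> \<U> T \<Longrightarrow> real (card (\<B> U)) \<le> y" "0 \<le> y" "0 \<le> c"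
  shows "real (card (\<Union>T\<in>\<T>. \<Union>U\<in>\<U> T. \<B> U)) \<le> b * (c * y)"
proof -
  have inner: "real (card (\<Union>U\<in>\<U> T. \<B> U)) \<le> c * y" if "T \<in> \<T>" for T
    using real_card_union_bound[where \<D> = "{}" and \<T> = "\<U> T" and \<B> = \<B> and Z = 0 and y = y and c = c,
        OF _ _ assms(3)[OF that] assms(1)[OF that] assms(4)] by simp
  show ?thesis
    using real_card_union_bound[where \<D> = "{}" and \<T> = \<T> and \<B> = "\<lambda>T. \<Union>U\<in>\<U> T. \<B> U"
        and Z = 0 and y = "c * y" and c = b, OF _ _ inner assms(2)] assms(4,5) by simp
qed

context
  fixes \<F> \<G> :: "'b set set" and E :: "'b set"
  assumes opt: "optimal \<F> \<G>"
    and E: "subspace E" "dim E = t" "\<forall>F\<in>\<F>. E \<subseteq> F"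
    and \<G>_le: "real (card \<G>) \<le> real q ^ (t + 1) * N t"
begin

section \<open>How the members of the two families lie relative to \<open>E\<close>\<close>

lemma subs: "\<F> \<subseteq> Sub" "\<G> \<subseteq> Sub"
  and few: "F \<in> \<F> \<Longrightarrow> card (def \<G> F t) \<le> s" "G \<in> \<G> \<Longrightarrow> card (def \<F> G t) \<le> s"
  and not_cross: "\<exists>F\<in>\<F>. \<exists>G\<in>\<G>. dim (F \<inter> G) < t"
  using opt unfolding optimal_def admissible_pair_iff by auto

lemma F_mem: "F \<in> \<F> \<Longrightarrow> subspace F \<and> dim F = k \<and> E \<subseteq> F"
  using subs E by (auto simp: mem_Sub)

lemma G_mem: "G \<in> \<G> \<Longrightarrow> subspace G \<and> dim G = k"
  using subs by (auto simp: mem_Sub)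

text \<open>With the rough bound on \<open>\<G>\<close>, two branching steps above \<open>E\<close>
  would make the product too small.\<close>

lemma F_not_small: "\<not> real (card \<F>) \<le> real q ^ (2 * k) * max (real s) (N (t + 2))"
proof
  assume le: "real (card \<F>) \<le> real q ^ (2 * k) * max (real s) (N (t + 2))"
  have Npos: "0 < N t" "0 < N (t + 1)" using N_pos k_ge by auto
  have "real (card \<F>) * real (card \<G>) \<le>
      (real q ^ (2 * k) * max (real s) (N (t + 2))) * (real q ^ (t + 1) * N t)"
    using le \<G>_le by (intro mult_mono) auto
  then have "13 * (real (card \<F>) * real (card \<G>)) \<le>
      (13 * real q ^ (2 * k + (t + 1)) * max (real s) (N (Suc (t + 1)))) * N t"
    unfolding power_add by (simp add: mult_ac)
  also have "\<dots> \<le> N (t + 1) * N t"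
    using N_small_mult(3)[of "t + 1" "2 * k + (t + 1)"] k_ge Npos by (intro mult_right_mono) auto
  finally show False by (rule optimal_not_small[OF opt])
qed

text \<open>If \<open>G\<close> met \<open>E\<close> in dimension at most \<open>t - 2\<close>, it
  would meet every space of dimension at most \<open>t + 1\<close> above \<open>E\<close> in less
  than \<open>t\<close>. The same \<open>G\<close> would then serve for two branching steps.\<close>

lemma dim_G_Int_E:
  assumes "G \<in> \<G>" "\<not> E \<subseteq> G"
  shows "Suc (dim (G \<inter> E)) = t"
proof -
  have G: "subspace G" "dim G = k" using G_mem assms by auto
  have "dim (G \<inter> E) < t"
  proof (rule ccontr)
    assume "\<not> ?thesis"
    then have "G \<inter> E = E"
      using E G by (intro subspace_dim_equal) (auto simp: subspace_inter)
    then show False using assms by blast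
  qed
  moreover have "\<not> dim (G \<inter> E) + 2 \<le> t"
  proof
    assume small: "dim (G \<inter> E) + 2 \<le> t"
    have "real (card (fam \<F> E)) \<le> real q ^ (k * 2) * max (real s) (N (dim E + 2))"
    proof (rule branching[OF subs few(2) E(1)])
      show "\<exists>G\<in>\<G>. dim (G \<inter> T) < t" if "subspace T" "E \<subseteq> T" "dim T < dim E + 2" for T
        using dim_Int_superspace_le[OF E(1) that(1,2) G(1)] small that assms(1) by force
    qed (use E k_ge in auto)
    moreover have "fam \<F> E = \<F>" using E by (auto simp: fam_def)
    ultimately show False using F_not_small E by (simp add: mult.commute)
  qed
  ultimately show ?thesis by linarith
qed

text \<open>Otherwise \<open>\<F>\<close> lies above a (t+1)-space \<open>T\<close>. In a deficient
  pair \<open>F0\<close>, \<open>G0\<close> the space \<open>T\<close> is inside \<open>F0\<close>,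
  so \<open>G0\<close> meets \<open>T\<close> in less than \<open>t\<close> and one branching step
  contradicts \<open>F_not_small\<close>.\<close>

lemma no_further_common_vector:
  assumes "v \<notin> E"
  shows "\<exists>F\<in>\<F>. v \<notin> F"
proof (rule ccontr)
  assume "\<not> ?thesis"
  then have v: "v \<in> F" if "F \<in> \<F>" for F using that by blast
  define T where "T = span (insert v E)"
  have T: "subspace T" "dim T = t + 1" using dim_span_insert[OF E(1) assms] E by (simp_all add: T_def)
  have TF: "T \<subseteq> F" if "F \<in> \<F>" for F
    unfolding T_def using F_mem[OF that] v[OF that] by (intro span_insert_subset) auto
  obtain F0 G0 where FG: "F0 \<in> \<F>" "G0 \<in> \<G>" "dim (F0 \<inter> G0) < t" using not_cross by blast
  have "dim (G0 \<inter> T) \<le> dim (F0 \<inter> G0)" using TF[OF FG(1)] by (intro dim_subset) auto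
  then have G0: "dim (G0 \<inter> T) < t" using FG by simp
  have "real (card (fam \<F> T)) \<le> real q ^ (k * 1) * max (real s) (N (dim T + 1))"
  proof (rule branching[OF subs few(2) T(1)])
    show "\<exists>G\<in>\<G>. dim (G \<inter> T') < t" if "subspace T'" "T \<subseteq> T'" "dim T' < dim T + 1" for T'
    proof -
      have "T = T'" using that T by (intro subspace_dim_equal) auto
      then show ?thesis using G0 FG by auto
    qed
  qed (use T k_ge in auto)
  also have "\<dots> \<le> real q ^ (2 * k) * max (real s) (N (t + 2))"
    using T by (simp add: mult_right_mono q_pow_mono)
  also have "fam \<F> T = \<F>" using TF by (auto simp: fam_def)
  finally show False using F_not_small by simp
qed

definition \<G>' :: "'b set set" where
  "\<G>' = {G \<in> \<G>. \<not> E \<subseteq> G}"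

text \<open>Some \<open>F\<close> misses a vector of \<open>E'\<close> outside \<open>E\<close>, so
  \<open>E'\<close> can be branched once.\<close>

lemma fam_G_le:
  assumes "subspace E'" "dim E' = t" "E' \<noteq> E"
  shows "real (card (fam \<G> E')) \<le> real q ^ k * N (t + 1)"
proof -
  have "\<not> E' \<subseteq> E" using subspace_dim_equal[of E' E] assms E by auto
  then obtain v where v: "v \<in> E'" "v \<notin> E" by auto
  then obtain F where F: "F \<in> \<F>" "v \<notin> F" using no_further_common_vector by blast
  have less: "dim (F \<inter> E') < t"
  proof (rule ccontr)
    assume "\<not> ?thesis"
    then have "F \<inter> E' = E'"
      using assms F_mem[OF F(1)] by (intro subspace_dim_equal) (auto simp: subspace_inter)
    then show False using v F by blast
  qed
  have "real (card (fam \<G> E')) \<le> real q ^ (k * 1) * max (real s) (N (dim E' + 1))"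
  proof (rule branching[OF subs(2,1) few(1) assms(1)])
    show "\<exists>F\<in>\<F>. dim (F \<inter> T') < t" if "subspace T'" "E' \<subseteq> T'" "dim T' < dim E' + 1" for T'
    proof -
      have "E' = T'" using that assms by (intro subspace_dim_equal) auto
      then show ?thesis using less F by auto
    qed
  qed (use assms k_ge in auto)
  also have "max (real s) (N (dim E' + 1)) = N (t + 1)"
    using s_le_N[of "t + 1"] k_ge assms by simp
  finally show ?thesis by simp
qed

text \<open>Fix \<open>F1\<close> in \<open>\<F>\<close>. Apart from \<open>s\<close> exceptions,
  \<open>G\<close> contains the hyperplane \<open>G \<inter> E\<close> of \<open>E\<close> and a
  vector of \<open>F1\<close> outside \<open>E\<close>, hence a \<open>t\<close>-space
  \<open>E'\<close> other than \<open>E\<close>. There are fewer than q^t hyperplanes and fewer than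
  q^(k-t+1) choices of \<open>E'\<close> for each; \<open>fam_G_le\<close> bounds the rest.\<close>

lemma card_G'_le: "13 * real (card \<G>') \<le> N t"
proof -
  obtain F1 where F1: "F1 \<in> \<F>" using not_cross by blast
  have F1': "subspace F1" "dim F1 = k" "E \<subseteq> F1" using F_mem[OF F1] by auto
  let ?W = "between {0} E (t - 1)" and ?U = "\<lambda>W. between W F1 t - {E}"
  let ?a = "real q ^ t" and ?b = "real q ^ (k - t + 1)" and ?y = "real q ^ k * N (t + 1)"
  have sub: "\<G>' \<subseteq> def \<G> F1 t \<union> (\<Union>W\<in>?W. \<Union>E'\<in>?U W. fam \<G> E')"
  proof
    fix G assume G: "G \<in> \<G>'"
    then have G': "G \<in> \<G>" "\<not> E \<subseteq> G" "subspace G" using G_mem by (auto simp: \<G>'_def)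
    show "G \<in> def \<G> F1 t \<union> (\<Union>W\<in>?W. \<Union>E'\<in>?U W. fam \<G> E')"
    proof (cases "dim (G \<inter> F1) < t")
      case True
      then show ?thesis using G' by (simp add: deficient_def)
    next
      case False
      define W0 where "W0 = G \<inter> E"
      have dW: "Suc (dim W0) = t" using dim_G_Int_E G' by (simp add: W0_def)
      have sW: "subspace W0" using G' E by (simp add: W0_def subspace_inter)
      have WG: "W0 \<subseteq> G" "W0 \<subseteq> E" by (auto simp: W0_def)
      have "\<not> G \<inter> F1 \<subseteq> W0" using False dW dim_subset[of "G \<inter> F1" W0] by linarith
      then obtain v where v: "v \<in> G" "v \<in> F1" "v \<notin> E" by (auto simp: W0_def)
      define E' where "E' = span (insert v W0)"
      have "dim E' = t" using dim_span_insert[OF sW, of v] v dW WG by (auto simp: E'_def)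
      moreover have "E' \<subseteq> G" "E' \<subseteq> F1"
        unfolding E'_def using v G' F1' WG by (intro span_insert_subset; blast)+
      moreover have "v \<in> E'" "W0 \<subseteq> E'" unfolding E'_def using span_superset[of "insert v W0"] by auto
      moreover have "subspace E'" by (simp add: E'_def)
      ultimately have "E' \<in> ?U W0" "G \<in> fam \<G> E'"
        using v G' by (auto simp: between_def fam_def)
      moreover have "W0 \<in> ?W" using sW dW subspace_0[OF sW] WG by (auto simp: between_def)
      ultimately show ?thesis by blast
    qed
  qed
  have one: "1 \<le> ?a" "1 \<le> ?b" "1 \<le> real q ^ k" using q_real by (intro one_le_power; simp)+
  have sy: "real s \<le> ?y"
    using mult_mono[of 1 "real q ^ k" "real s" "N (t + 1)"] one s_le_N[of "t + 1"] k_ge by simp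
  have "real (card (\<Union>W\<in>?W. \<Union>E'\<in>?U W. fam \<G> E')) \<le> (?a - 1) * ((?b - 1) * ?y)"
  proof (rule nested_union_bound)
    show "real (card (?U W)) \<le> ?b - 1" if "W \<in> ?W" for W
    proof -
      have W: "subspace W" "W \<subseteq> F1" "dim W = t - 1" using that F1' by (auto simp: between_def)
      have "card (?U W) \<le> card (between W F1 (Suc (dim W)))" using W t_pos by (intro card_mono) auto
      moreover have "real (card (between W F1 (Suc (dim W)))) \<le> ?b - 1"
        using W F1' k_ge by (intro card_points_le) auto
      ultimately show ?thesis by linarith
    qed
    show "real (card ?W) \<le> ?a - 1"
      using card_subspaces_less[of E "t - 1" 1] E t_pos by simp
    show "real (card (fam \<G> E')) \<le> ?y" if "W \<in> ?W" "E' \<in> ?U W" for W E'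
      using that by (intro fam_G_le) (auto simp: between_def)
  qed (use one sy in auto)
  then have "real (card (def \<G> F1 t \<union> (\<Union>W\<in>?W. \<Union>E'\<in>?U W. fam \<G> E'))) \<le> real s + (?a - 1) * ((?b - 1) * ?y)"
    using few(1)[OF F1] card_Un_le[of "def \<G> F1 t" "\<Union>W\<in>?W. \<Union>E'\<in>?U W. fam \<G> E'"] by linarith
  moreover have "card \<G>' \<le> card (def \<G> F1 t \<union> (\<Union>W\<in>?W. \<Union>E'\<in>?U W. fam \<G> E'))"
    using sub by (intro card_mono) auto
  moreover have "real s + (?a - 1) * ((?b - 1) * ?y) \<le> ?a * ?b * ?y"
  proof -
    have "?y * (?a - 1) + ?y * (?b - 1) \<ge> 0" using one sy by simp
    then have "?a * ?b * ?y - (?a - 1) * ((?b - 1) * ?y) \<ge> ?y" by (simp add: algebra_simps)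
    then show ?thesis using sy by linarith
  qed
  ultimately have "real (card \<G>') \<le> ?a * ?b * ?y" by linarith
  also have "\<dots> = real q ^ (t + (k - t + 1) + k) * N (Suc t)" by (simp add: power_add)
  finally show ?thesis using N_small_mult(2)[of t "t + (k - t + 1) + k"] k_ge by simp
qed

text \<open>Improves the rough bound q^(t+1) \<open>N t\<close> to one close enough to
  \<open>N t\<close> for \<open>span_G_E_unique\<close>.\<close>

lemma card_G_le: "real (card \<G>) \<le> 14 / 13 * N t"
proof -
  have "\<G> = fam \<G> E \<union> \<G>'" by (auto simp: fam_def \<G>'_def)
  then have "card \<G> \<le> card (fam \<G> E) + card \<G>'" by (metis card_Un_le)
  then show ?thesis using card_fam_le[OF subs(2) E(1)] card_G'_le E k_ge by simp
qed

lemma span_G_E: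
  assumes "G \<in> \<G>'"
  shows "dim (span (G \<union> E)) = k + 1" "G \<subseteq> span (G \<union> E)" "E \<subseteq> span (G \<union> E)"
proof -
  have G: "G \<in> \<G>" "\<not> E \<subseteq> G" "subspace G" "dim G = k" using assms G_mem by (auto simp: \<G>'_def)
  show "dim (span (G \<union> E)) = k + 1"
    using dim_span_Un[of G E] dim_G_Int_E[OF G(1,2)] G E by simp
  show "G \<subseteq> span (G \<union> E)" "E \<subseteq> span (G \<union> E)" using span_superset[of "G \<union> E"] by auto
qed

lemma deficient_F_iff:
  assumes "G \<in> \<G>'" "F \<in> \<F>"
  shows "dim (F \<inter> G) < t \<longleftrightarrow> F \<inter> span (G \<union> E) = E"
  by (rule deficient_iff)
    (use assms span_G_E[OF assms(1)] E F_mem[OF assms(2)] G_mem in \<open>auto simp: \<G>'_def\<close>)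

text \<open>With two different sums \<open>X\<close> and \<open>Y\<close>, a nondeficient
  \<open>F\<close> must contain more than \<open>E\<close> from both. It does so inside
  \<open>X \<inter> Y\<close>, which offers at most half of the \<open>p\<close> choices, or through
  a (t+2)-space, which is rare.\<close>

lemma span_G_E_unique:
  assumes "G1 \<in> \<G>'" "G2 \<in> \<G>'"
  shows "span (G1 \<union> E) = span (G2 \<union> E)"
proof (rule ccontr)
  assume ne: "\<not> ?thesis"
  define X where "X = span (G1 \<union> E)"
  define Y where "Y = span (G2 \<union> E)"
  have X: "subspace X" "dim X = k + 1" "E \<subseteq> X" and Y: "subspace Y" "dim Y = k + 1" "E \<subseteq> Y"
    using span_G_E assms by (auto simp: X_def Y_def)
  have XY: "subspace (X \<inter> Y)" using X Y by (simp add: subspace_inter)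
  have dXY: "dim (X \<inter> Y) \<le> k"
  proof (rule ccontr)
    assume "\<not> ?thesis"
    then have "X \<inter> Y = X" "X \<inter> Y = Y"
      using X Y XY subspace_dim_equal[of "X \<inter> Y" X] subspace_dim_equal[of "X \<inter> Y" Y] by auto
    then show False using ne by (simp add: X_def Y_def)
  qed
  let ?D = "def \<F> G1 t \<union> def \<F> G2 t"
  let ?A = "\<Union>L\<in>between E (X \<inter> Y) (Suc t). fam \<F> L"
  let ?B = "\<Union>L\<in>between E X (Suc t). \<Union>M\<in>between L (span (L \<union> Y)) (t + 2). fam \<F> M"
  let ?b = "real q ^ (k - t + 1)"
  have sub: "\<F> \<subseteq> ?D \<union> ?A \<union> ?B"
  proof
    fix F assume F: "F \<in> \<F>"
    have F': "subspace F" "E \<subseteq> F" using F_mem[OF F] by auto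
    consider "F \<in> ?D" | v where "v \<in> F" "v \<in> X \<inter> Y" "v \<notin> E"
      | v w where "F \<inter> (X \<inter> Y) = E" "v \<in> F" "v \<in> X" "v \<notin> E" "w \<in> F" "w \<in> Y" "w \<notin> E"
    proof (cases "F \<in> ?D")
      case False
      then have "F \<inter> X \<noteq> E" "F \<inter> Y \<noteq> E"
        using deficient_F_iff[OF assms(1) F] deficient_F_iff[OF assms(2) F] F
        by (auto simp: deficient_def X_def Y_def)
      then have "\<not> F \<inter> X \<subseteq> E" "\<not> F \<inter> Y \<subseteq> E" using F' X(3) Y(3) by auto
      then obtain v w where "v \<in> F" "v \<in> X" "v \<notin> E" "w \<in> F" "w \<in> Y" "w \<notin> E" by blast
      show ?thesis
      proof (cases "F \<inter> (X \<inter> Y) = E")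
        case True
        then show ?thesis by (rule that(3)) fact+
      next
        case False
        then obtain u where "u \<in> F" "u \<in> X \<inter> Y" "u \<notin> E" using F' X(3) Y(3) by blast
        then show ?thesis by (rule that(2))
      qed
    qed
    then show "F \<in> ?D \<union> ?A \<union> ?B"
    proof cases
      case 1
      then show ?thesis by blast
    next
      case (2 v)
      have "span (insert v E) \<subseteq> F" "span (insert v E) \<subseteq> X \<inter> Y"
        using 2 F' XY X Y by (simp_all add: span_insert_subset del: Int_subset_iff)
      then have "span (insert v E) \<in> between E (X \<inter> Y) (Suc t)" "F \<in> fam \<F> (span (insert v E))"
        using dim_span_insert[OF E(1) 2(3)] E F span_superset[of "insert v E"]
        by (auto simp: between_def fam_def simp del: dim_span)
      then show ?thesis by blast
    next
      case (3 v w)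
      define L where "L = span (insert v E)"
      have L: "subspace L" "dim L = Suc t" "E \<subseteq> L"
        using dim_span_insert[OF E(1) 3(4)] E span_superset[of "insert v E"] by (auto simp: L_def)
      have LF: "L \<subseteq> F" "L \<subseteq> X" unfolding L_def using 3 F' X by (simp_all add: span_insert_subset)
      \<comment> \<open>A vector of \<open>L\<close> lies in \<open>F \<inter> X\<close>; if it were
        \<open>w\<close>, it would lie in \<open>F \<inter> (X \<inter> Y) = E\<close>.\<close>
      have wL: "w \<notin> L" using 3 LF by blast
      define M where "M = span (insert w L)"
      have "M \<subseteq> F" unfolding M_def using LF 3 F' by (simp add: span_insert_subset)
      moreover have "dim M = t + 2" unfolding M_def using dim_span_insert[OF L(1) wL] L by simp
      moreover have "L \<subseteq> M" unfolding M_def using span_superset[of "insert w L"] by auto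
      moreover have "M \<subseteq> span (L \<union> Y)" unfolding M_def using 3 by (intro span_mono) auto
      moreover have "subspace M" by (simp add: M_def)
      ultimately have "M \<in> between L (span (L \<union> Y)) (t + 2)" "F \<in> fam \<F> M"
        using F by (auto simp: between_def fam_def)
      moreover have "L \<in> between E X (Suc t)" using L LF by (simp add: between_def)
      ultimately show ?thesis by blast
    qed
  qed
  have Npos: "0 < N t" "0 < N (t + 1)" "0 < N (t + 2)" using N_pos k_ge by auto
  have cD: "real (card ?D) \<le> 2 * real s"
    using card_Un_le[of "def \<F> G1 t" "def \<F> G2 t"] few(2)[of G1] few(2)[of G2] assms
    by (simp add: \<G>'_def)
  \<comment> \<open>The half comes from \<open>X \<inter> Y\<close> having smaller dimension than
    \<open>X\<close>.\<close>
  have cL: "real (card (between E (X \<inter> Y) (Suc t))) \<le> p / 2"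
  proof -
    have "real (card (between E (X \<inter> Y) (Suc t))) = (real q ^ (dim (X \<inter> Y) - t) - 1) / (real q - 1)"
      using card_points[OF E(1) XY] X Y E by simp
    also have "\<dots> \<le> (real q ^ (k - t) - 1) / (real q - 1)"
      using dXY q_real by (intro divide_right_mono diff_right_mono q_pow_mono) auto
    also have "\<dots> \<le> ((?b - 1) / 2) / (real q - 1)"
    proof (rule divide_right_mono)
      have "2 * real q ^ (k - t) \<le> ?b" using q_pow_double[of "k - t"] by simp
      moreover have "x - 1 \<le> (y - 1) / 2" if "2 * x \<le> y" for x y :: real
        using that by simp
      ultimately show "real q ^ (k - t) - 1 \<le> (?b - 1) / 2" by blast
    qed (use q_real in simp)
    finally show ?thesis by (simp add: p_def mult.commute)
  qed
  have cA: "real (card ?A) \<le> 0 + p / 2 * N (t + 1)"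
  proof (rule real_card_union_bound[where \<D> = "{}"])
    show "real (card (fam \<F> L)) \<le> N (t + 1)" if "L \<in> between E (X \<inter> Y) (Suc t)" for L
      using that card_fam_le[OF subs(1), of L] k_ge by (auto simp: between_def)
  qed (use cL Npos in auto)
  have cB: "real (card ?B) \<le> p * (?b * N (t + 2))"
  proof (rule nested_union_bound)
    show "real (card (between L (span (L \<union> Y)) (t + 2))) \<le> ?b" if "L \<in> between E X (Suc t)" for L
    proof -
      have L: "subspace L" "dim L = t + 1" "E \<subseteq> L" using that by (auto simp: between_def)
      \<comment> \<open>\<open>E\<close> lies in both \<open>L\<close> and \<open>Y\<close>, so
        their sum exceeds \<open>L\<close> by at most \<open>k - t + 1\<close> dimensions.\<close>
      have "t \<le> dim (L \<inter> Y)" using dim_subset[of E "L \<inter> Y"] L Y E by simp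
      then have "dim (span (L \<union> Y)) \<le> dim L + (k - t + 1)"
        using dim_span_Un[of L Y] L Y k_ge by linarith
      then have "real (card (between L (span (L \<union> Y)) (Suc (dim L)))) \<le> ?b - 1"
        using L span_superset[of "L \<union> Y"] by (intro card_points_le) auto
      then show ?thesis using L by simp
    qed
    show "real (card (between E X (Suc t))) \<le> p"
      using card_points[OF E(1) X(1)] X E k_ge by (simp add: p_def Suc_diff_le)
    show "real (card (fam \<F> M)) \<le> N (t + 2)" if "M \<in> between L (span (L \<union> Y)) (t + 2)" for L M
      using that card_fam_le[OF subs(1), of M] k_ge by (auto simp: between_def)
  qed (use Npos in auto)
  have "card \<F> \<le> card (?D \<union> ?A \<union> ?B)" using sub by (intro card_mono) auto
  then have "real (card \<F>) \<le> real (card ?D) + real (card ?A) + real (card ?B)"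
    using card_Un_le[of "?D \<union> ?A" ?B] card_Un_le[of ?D ?A] by linarith
  then have c: "real (card \<F>) \<le> 2 * real s + p / 2 * N (t + 1) + p * (?b * N (t + 2))"
    using cD cA cB by linarith
  have "k - t + 1 \<le> 2 * k + 3 * t + 1" by linarith
  then have "13 * (?b * N (t + 2)) \<le> N (t + 1)"
    using N_small_mult(2)[of "t + 1" "k - t + 1"] k_ge by (simp add: mult_ac)
  then have "p * (13 * (?b * N (t + 2))) \<le> p * N (t + 1)"
    using p_ge_4 by (intro mult_left_mono) auto
  moreover have "13 * real s \<le> N (t + 1)" using N_small_mult(1)[of "t + 1" 0] k_ge by simp
  moreover have "4 * N (t + 1) \<le> p * N (t + 1)" using p_ge_4 Npos by (intro mult_right_mono) auto
  \<comment> \<open>The three terms are at most 1/26, 1/2 and 1/13 of \<open>p * N (t + 1)\<close>;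
    their sum 8/13 is below 5/8.\<close>
  ultimately have c\<F>: "real (card \<F>) \<le> 5 / 8 * (p * N (t + 1))" using c by simp
  have pN: "0 < p * N (t + 1) * N t" using p_ge_4 Npos by simp
  \<comment> \<open>5/8 times 14/13 is 35/52, below the 7/8 of \<open>optimal_large\<close>.\<close>
  have "real (card \<F>) * real (card \<G>) \<le> 5 / 8 * (p * N (t + 1)) * (14 / 13 * N t)"
    using c\<F> card_G_le p_ge_4 Npos by (intro mult_mono) auto
  then show False using optimal_large[OF opt] pN by (simp add: mult_ac)
qed

text \<open>With a single \<open>X\<close>, the deficient pairs are those of \<open>\<S>\<close>
  with \<open>\<G>'\<close>. The sizes are part of the conclusion because they exclude the case with
  the families exchanged in \<open>maximum_structure\<close>.\<close>

lemma optimal_structure: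
  "\<exists>X \<A> \<B>. subspace X \<and> dim X = k + 1 \<and> E \<subseteq> X \<and>
    \<F> = between E UNIV k - \<A> \<and> \<G> = between E UNIV k \<union> \<B> \<and>
    \<A> \<subseteq> ext X E UNIV k \<and> real (card \<A>) = h2 - real s \<and>
    \<B> \<subseteq> between {0} X k - between E X k \<and> real (card \<B>) = min (real s) hB \<and>
    real (card \<F>) = N t - h2 + real s \<and> real (card \<G>) = N t + min (real s) hB"
proof -
  let ?H = "between E UNIV k"
  have \<G>'_ex: "\<exists>G0. G0 \<in> \<G>'"
    using not_cross F_mem G_mem dim_Int_common[OF _ _ _ _ E(2)] by (force simp: \<G>'_def)
  then obtain G0 where G0: "G0 \<in> \<G>'" ..
  define X where "X = span (G0 \<union> E)"
  let ?H2 = "ext X E UNIV k"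
  have X: "subspace X" "dim X = k + 1" "E \<subseteq> X" using span_G_E[OF G0] by (auto simp: X_def)
  have span_X: "span (G \<union> E) = X" if "G \<in> \<G>'" for G
    using span_G_E_unique[OF that G0] by (simp add: X_def)
  have iff: "dim (F \<inter> G) < t \<longleftrightarrow> F \<inter> X = E" if "F \<in> \<F>" "G \<in> \<G>'" for F G
    using deficient_F_iff[OF that(2,1)] span_X[OF that(2)] by simp
  define \<S> where "\<S> = \<F> \<inter> ?H2"
  have \<S>_iff: "F \<in> \<S> \<longleftrightarrow> F \<in> \<F> \<and> F \<inter> X = E" for F
    using F_mem by (auto simp: \<S>_def ext_def)
  have "\<S> = def \<F> G0 t" using \<S>_iff iff G0 by (auto simp: deficient_def)
  then have cS: "card \<S> \<le> s" using few(2)[of G0] G0 by (simp add: \<G>'_def)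
  \<comment> \<open>One deficient pair suffices: its \<open>F0\<close> lies in \<open>\<S>\<close>
    and is therefore deficient with all of \<open>\<G>'\<close>, which bounds \<open>\<G>'\<close>
    by \<open>s\<close>.\<close>
  obtain F0 G1 where FG: "F0 \<in> \<F>" "G1 \<in> \<G>" "dim (F0 \<inter> G1) < t" using not_cross by blast
  have "\<not> E \<subseteq> G1" using FG F_mem[of F0] G_mem[of G1] dim_Int_common[of F0 G1 E] E(2) by auto
  then have "F0 \<in> \<S>" using FG iff[of F0 G1] \<S>_iff by (simp add: \<G>'_def)
  have "\<G>' \<subseteq> def \<G> F0 t"
    using iff[OF FG(1)] \<S>_iff \<open>F0 \<in> \<S>\<close> by (auto simp: deficient_def \<G>'_def Int_commute)
  then have c1: "card \<G>' \<le> s" using few(1)[OF FG(1)] card_mono[of "def \<G> F0 t" \<G>'] by simp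
  have \<G>'_sub: "\<G>' \<subseteq> between {0} X k - between E X k"
    using span_G_E(2) span_X G_mem by (fastforce simp: between_def \<G>'_def subspace_0)
  then have "card \<G>' \<le> card (between {0} X k - between E X k)" by (intro card_mono) auto
  then have c2: "real (card \<G>') \<le> hB" using card_hyperplanes_avoiding[OF X(1,2) E(1,2) X(3)] by simp
  have H2H: "?H2 \<subseteq> ?H" by (auto simp: ext_def between_def)
  have cH: "real (card ?H) = N t" using card_above[OF E(1)] E k_ge by simp
  have cHH: "real (card (?H - ?H2)) = N t - h2"
    using H2H cH card_H2[OF X(1,2) E(1,2) X(3)] by (simp add: card_Diff_subset of_nat_diff card_mono)
  have \<F>H: "\<F> \<subseteq> ?H" using F_mem by (auto simp: between_def)
  then have \<F>_sub: "\<F> \<subseteq> (?H - ?H2) \<union> \<S>" by (auto simp: \<S>_def)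
  have \<G>_sub: "\<G> \<subseteq> ?H \<union> \<G>'" using G_mem by (auto simp: between_def \<G>'_def)
  have cU: "real (card ((?H - ?H2) \<union> \<S>)) \<le> N t - h2 + real s"
    using card_Un_le[of "?H - ?H2" \<S>] cHH cS by linarith
  have cV: "real (card (?H \<union> \<G>')) \<le> N t + real (card \<G>')"
    using card_Un_le[of ?H \<G>'] cH by linarith
  have f_le: "real (card \<F>) \<le> N t - h2 + real s"
    using card_mono[OF _ \<F>_sub] cU by simp
  have g_le': "real (card \<G>) \<le> N t + real (card \<G>')"
    using card_mono[OF _ \<G>_sub] cV by simp
  then have g_le: "real (card \<G>) \<le> N t + min (real s) hB" using c1 c2 by simp
  have prod: "(N t - h2 + real s) * (N t + min (real s) hB) \<le> real (card \<F>) * real (card \<G>)"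
    using opt by (simp add: optimal_def)
  have "0 < p * N (t + 1)" using p_ge_4 N_pos[of "t + 1"] k_ge by simp
  then have pos: "0 < N t - h2 + real s" "0 < N t + min (real s) hB"
    using h2_upper N_pos[of t] k_ge hB_pos by (simp_all add: add_pos_nonneg)
  \<comment> \<open>Both upper bounds are positive and their product is attained, so each must be
    attained.\<close>
  have f_eq: "real (card \<F>) = N t - h2 + real s"
  proof (rule ccontr)
    assume "\<not> ?thesis"
    then have "real (card \<F>) < N t - h2 + real s" using f_le by simp
    then have "real (card \<F>) * (N t + min (real s) hB) < (N t - h2 + real s) * (N t + min (real s) hB)"
      using pos by (intro mult_strict_right_mono)
    moreover have "real (card \<F>) * real (card \<G>) \<le> real (card \<F>) * (N t + min (real s) hB)"
      using g_le by (intro mult_left_mono) auto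
    ultimately show False using prod by linarith
  qed
  have "(N t - h2 + real s) * (N t + min (real s) hB) \<le> (N t - h2 + real s) * real (card \<G>)"
    using prod unfolding f_eq .
  then have "N t + min (real s) hB \<le> real (card \<G>)" using pos(1) by simp
  then have g_eq: "real (card \<G>) = N t + min (real s) hB" using g_le by simp
  then have cB: "real (card \<G>') = min (real s) hB" using g_le' c1 c2 by simp
  have "\<F> = (?H - ?H2) \<union> \<S>"
    using \<F>_sub cU f_eq by (intro card_seteq) auto
  then have A: "?H - \<F> \<subseteq> ?H2" by blast
  have "\<G> = ?H \<union> \<G>'"
    using \<G>_sub cV g_eq cB by (intro card_seteq) auto
  moreover have "\<F> = ?H - (?H - \<F>)" using \<F>H by blast
  moreover have "real (card (?H - \<F>)) = h2 - real s"
    using \<F>H cH f_eq by (simp add: card_Diff_subset of_nat_diff card_mono)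
  ultimately show ?thesis
    using X A \<G>'_sub cB f_eq g_eq
    by (intro exI[of _ X] exI[of _ "?H - \<F>"] exI[of _ \<G>'] conjI) assumption+
qed

end

section \<open>Return to the notation of the theorem\<close>

lemma subspaces_of_dim_eq_between: "subspaces_of_dim scale X m = between {0} X m"
  by (auto simp: between_def mem_subspaces_of_dim subspace_0)

lemma H1_eq_between: "H1 scale X E m = between E X m"
  by (auto simp: H1_def between_def mem_subspaces_of_dim)

lemma H2_eq_ext: "H2 scale X E m = ext X E UNIV m"
  by (auto simp: H2_def ext_def mem_subspaces_of_dim)

theorem maximum_structure:
  assumes adm: "admissible_pair scale k s t \<F> \<G>"
    and max: "\<And>\<F>' \<G>'. admissible_pair scale k s t \<F>' \<G>' \<Longrightarrow> card \<F>' * card \<G>' \<le> card \<F> * card \<G>"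
    and le: "card \<F> \<le> card \<G>"
  shows "\<exists>X \<in> subspaces_of_dim scale UNIV (k + 1). \<exists>E \<in> subspaces_of_dim scale X t. \<exists>\<A> \<B>.
    \<F> = H1 scale UNIV E k - \<A> \<and> \<G> = H1 scale UNIV E k \<union> \<B> \<and>
    \<A> \<subseteq> H2 scale X E k \<and> real (card \<A>) = h2 - real s \<and>
    \<B> \<subseteq> subspaces_of_dim scale X k - H1 scale X E k \<and> real (card \<B>) = min (real s) hB"
proof -
  obtain \<F>' \<G>' where c: "admissible_pair scale k s t \<F>' \<G>'"
    "real (card \<F>') = N t - h2 + real s" "real (card \<G>') = N t + min (real s) hB"
    by (rule construction)
  have "real (card \<F>' * card \<G>') \<le> real (card \<F> * card \<G>)" using max[OF c(1)] by (simp only: of_nat_le_iff)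
  then have opt: "optimal \<F> \<G>" using adm c by (simp add: optimal_def)
  from optimal_dichotomy[OF opt] show ?thesis
  proof
    assume "(\<exists>E. subspace E \<and> dim E = t \<and> (\<forall>F\<in>\<F>. E \<subseteq> F)) \<and> real (card \<G>) \<le> real q ^ (t + 1) * N t"
    then obtain E where E: "subspace E" "dim E = t" "\<forall>F\<in>\<F>. E \<subseteq> F"
      and \<G>: "real (card \<G>) \<le> real q ^ (t + 1) * N t" by blast
    obtain X \<A> \<B> where X: "subspace X" "dim X = k + 1" "E \<subseteq> X"
      and AB: "\<F> = between E UNIV k - \<A>" "\<G> = between E UNIV k \<union> \<B>"
      "\<A> \<subseteq> ext X E UNIV k" "real (card \<A>) = h2 - real s"
      "\<B> \<subseteq> between {0} X k - between E X k" "real (card \<B>) = min (real s) hB"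
      using optimal_structure[OF opt E \<G>] by (elim exE conjE) (rule that)
    have XE: "X \<in> subspaces_of_dim scale UNIV (k + 1)" "E \<in> subspaces_of_dim scale X t"
      using X E by (simp_all add: mem_subspaces_of_dim)
    show ?thesis
    proof (rule bexI[OF _ XE(1)], rule bexI[OF _ XE(2)])
      show "\<exists>\<A> \<B>. \<F> = H1 scale UNIV E k - \<A> \<and> \<G> = H1 scale UNIV E k \<union> \<B> \<and>
        \<A> \<subseteq> H2 scale X E k \<and> real (card \<A>) = h2 - real s \<and>
        \<B> \<subseteq> subspaces_of_dim scale X k - H1 scale X E k \<and> real (card \<B>) = min (real s) hB"
        unfolding H1_eq_between H2_eq_ext subspaces_of_dim_eq_between[of _ k]
        by (rule exI[of _ \<A>], rule exI[of _ \<B>]) (intro conjI AB)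
    qed
  next
    assume "(\<exists>E. subspace E \<and> dim E = t \<and> (\<forall>G\<in>\<G>. E \<subseteq> G)) \<and> real (card \<F>) \<le> real q ^ (t + 1) * N t"
    then obtain E where E: "subspace E" "dim E = t" "\<forall>G\<in>\<G>. E \<subseteq> G"
      and \<F>: "real (card \<F>) \<le> real q ^ (t + 1) * N t" by blast
    \<comment> \<open>Here \<open>\<G>\<close> would have at most \<open>N t\<close> members and
      \<open>\<F>\<close> more than \<open>N t\<close>, against the order of the sizes.\<close>
    have "real (card \<G>) = N t - h2 + real s" "real (card \<F>) = N t + min (real s) hB"
      using optimal_structure[OF optimal_swap[OF opt] E \<F>] by auto
    moreover have "0 < min (real s) hB" using s_pos hB_pos by simp
    ultimately show ?thesis using le s_le_h2 by linarith
  qed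
qed

end

theorem theorem4p2:
  fixes scale :: "'a::{field,finite} \<Rightarrow> 'b::ab_group_add \<Rightarrow> 'b"
    and q n k t s :: nat
    and \<F> \<G> :: "'b set set"
  assumes "vector_space scale"
    and "q = card (UNIV :: 'a set)"
    and "vector_space.dim scale (UNIV :: 'b set) = n"
    and "n > 0" and "k > 0" and "t > 0" and "s > 0"
    and "k \<ge> t + 2"
    and "real n \<ge> 3 * real k + 3 * real t + 1 + log (real q) (13 * real s)"
    and "admissible_pair scale k s t \<F> \<G>"
    and "\<And>\<F>' \<G>'. admissible_pair scale k s t \<F>' \<G>' \<Longrightarrow>
           card \<F>' * card \<G>' \<le> card \<F> * card \<G>"
    and "card \<F> \<le> card \<G>"
  shows "\<exists>X \<in> subspaces_of_dim scale UNIV (k + 1).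
         \<exists>E \<in> subspaces_of_dim scale X t.
         \<exists>\<A> \<B>.
           \<F> = H1 scale UNIV E k - \<A> \<and>
           \<G> = H1 scale UNIV E k \<union> \<B> \<and>
           \<A> \<subseteq> H2 scale X E k \<and>
           real (card \<A>) =
             real q ^ ((k - t) * (k - t + 1)) * gauss_binom q (int n - int k - 1) (int k - int t)
               - real s \<and>
           \<B> \<subseteq> subspaces_of_dim scale X k - H1 scale X E k \<and>
           real (card \<B>) = min (real s) (real q ^ (k - t + 1) * gauss_binom q (int t) 1)"
proof -
  interpret V: vector_space scale by fact
  obtain Basis where B: "V.independent Basis" "UNIV \<subseteq> V.span Basis" "card Basis = V.dim UNIV"
    using V.basis_exists[of UNIV] by metis
  have cB: "card Basis = n" using B(3) assms(3) by simp
  \<comment> \<open>An infinite set has \<open>card\<close> 0, whereas \<open>n\<close> is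
    positive.\<close>
  then have "finite Basis" using assms(4) card_ge_0_finite by metis
  then interpret W: finite_field_space scale Basis q
    using B assms(2) by unfold_locales auto
  have q: "2 \<le> real q" by (rule W.q_real)
  have s13: "1 \<le> 13 * real s" using assms(7) by simp
  \<comment> \<open>A nonnegative logarithm gives \<open>n\<close> at least 3k+3t+1, so the natural
    subtractions below are exact.\<close>
  then have log0: "0 \<le> log (real q) (13 * real s)" using q by simp
  then have "real (3 * k + 3 * t + 1) \<le> real n" using assms(9) by simp
  then have n: "3 * k + 3 * t + 1 \<le> n" by (simp only: of_nat_le_iff)
  \<comment> \<open>Exponentiating bounds 13s by q^(n-(3k+3t+1)); the factor q^(2k+3t+1) then yields
    the exponent \<open>n - k\<close> of \<open>q_pow_n\<close>.\<close>
  have "13 * real s = real q powr log (real q) (13 * real s)" using q s13 by simp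
  also have "\<dots> \<le> real q powr real (n - (3 * k + 3 * t + 1))"
    using q assms(9) n by (intro powr_mono) (auto simp: of_nat_diff)
  also have "\<dots> = real q ^ (n - (3 * k + 3 * t + 1))" using q by (simp add: powr_realpow)
  finally have "13 * real s * real q ^ (2 * k + 3 * t + 1)
      \<le> real q ^ (n - (3 * k + 3 * t + 1)) * real q ^ (2 * k + 3 * t + 1)"
    by (intro mult_right_mono) auto
  also have "\<dots> = real q ^ (n - k)"
    unfolding power_add[symmetric] by (rule arg_cong[of _ _ "\<lambda>i. real q ^ i"]) (use n in simp)
  finally interpret S: intersecting_setup scale Basis q n k t s
    using cB assms(6-8) n by unfold_locales auto
  show ?thesis
    using S.maximum_structure[OF assms(10,11,12)]
    unfolding S.h2_eq_gauss_binom S.hB_eq_gauss_binom .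
qed

end
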